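(* Suppose that the observations are given by $y^n(k,c)=F(k,c)+\epsilon^n(k,c)$, where $\epsilon^n(k,c)\sim\mathcal N(0,\sigma^2(k,c))$ and the $\epsilon^n(k,c)$ are independent across $n,k,c$, and that the best alternative $\pi^*(c)=\arg\max_{k\in\mathcal K}F(k,c)$ is unique for all $c\in\mathcal C$. Let the rewards be predicted by the Gaussian process posterior mean $\mu_n(k,c)$, and let $p(k,c)$ denote the fraction of samples allocated to $(k,c)$. Then the large deviations rate function for both $PCS^n_E$ and $PCS^n_M$ is given by $$\lim_{n\to\infty}\frac1n\log PFS^n_{\sim}=-\min_{c\in\mathcal C}\ \min_{k\neq\pi^*(c)}\frac{\big(F(\pi^*(c),c)-F(k,c)\big)^2}{2\left(\dfrac{\sigma^2(\pi^*(c),c)}{p(\pi^*(c),c)}+\dfrac{\sigma^2(k,c)}{p(k,c)}\right)},$$ where $PFS^n_{\sim}$ is either of $PFS^n_E$ or $PFS^n_M$.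
   Context: Setting. $\mathcal K$ is a finite set of alternatives, $\mathcal C\subset\mathbb R^d$ is a finite set of contexts, and $F:\mathcal K\times\mathcal C\to\mathbb R$ is the unknown reward function. Each sample of a pair $(k,c)$ returns $F(k,c)$ plus Gaussian noise of known variance $\sigma^2(k,c)$. Probabilities are with respect to the observation noise, with $F$ fixed. Allocation. With $n$ denoting the total number of samples, the number of samples allocated to $(k,c)$ is $N_n(k,c)=n\,p(k,c)$, where the fractions $p(k,c)$ are determined by the sampling policy and are strictly positive; technicalities arising from $n\,p(k,c)$ not being an integer are ignored. Gaussian process (GP) predictor. For each alternative $k$ separately, a GP prior over contexts with mean $\mu_0(k,\cdot)$ and covariance $\Sigma_0(\cdot,\cdot;k)$ is used. Let $D_n(k)$ be the list (with repetitions) of contexts sampled for alternative $k$ among the first $n$ samples and $Y_n(k)$ the corresponding column vector of observations. The posterior mean is $$\mu_n(k,c)=\mu_0(k,c)+\Sigma_0(c,D_n(k);k)\,A_n(k)^{-1}\,\big(Y_n(k)-\mu_0(k,D_n(k))\big),$$ with $A_n(k)=\Sigma_0(D_n(k),D_n(k);k)+\mathrm{diag}(\sigma^2(k,D_n(k)))$. Contextual probability of false selection. $\pi^n(c)=\arg\max_{k\in\mathcal K}\mu_n(k,c)$ and $PCS^n(c)=P(\pi^n(c)=\pi^*(c))$. Given a set of normalized weights (a probability distribution) $\{w(c):c\in\mathcal C\}$, $PCS^n_E=\sum_{c\in\mathcal C}w(c)\,PCS^n(c)$; and $PCS^n_M=\min_{c\in\mathcal C}PCS^n(c)$. Finally $PFS^n_E=1-PCS^n_E$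 and $PFS^n_M=1-PCS^n_M$.
   Formalization: Adds that each prior covariance Σ0(·,·;k) is strictly positive definite on the contexts (with Σ0=0 the posterior mean never learns) and that all weights w(c) are positive (a zero weight at the minimizing context changes the PFS_E rate); both claims are false without these. *)

theory Defs
  imports "HOL-Probability.Probability" "Jordan_Normal_Form.Gauss_Jordan_Elimination"
begin

(* The sampling policy is a fixed sequence s of alternative-context pairs; the i-th sample
   (i = 0, 1, ...) is taken at s i, so the first n samples are those with i < n. *)

definition num_samples :: "(nat \<Rightarrow> 'k \<times> 'c) \<Rightarrow> nat \<Rightarrow> 'k \<Rightarrow> 'c \<Rightarrow> nat" where
  "num_samples s n k c = card {i. i < n \<and> s i = (k, c)}"

definition sample_times :: "(nat \<Rightarrow> 'k \<times> 'c) \<Rightarrow> nat \<Rightarrow> 'k \<Rightarrow> nat list" where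
  "sample_times s n k = filter (\<lambda>i. fst (s i) = k) [0..<n]"

definition sampled_contexts :: "(nat \<Rightarrow> 'k \<times> 'c) \<Rightarrow> nat \<Rightarrow> 'k \<Rightarrow> 'c list" where
  "sampled_contexts s n k = map (\<lambda>i. snd (s i)) (sample_times s n k)"

(* Y i k c is the value that the i-th sample returns if it is taken at (k, c); only the values
   Y i (fst (s i)) (snd (s i)) are observed. *)
definition observations ::
  "(nat \<Rightarrow> 'k \<times> 'c) \<Rightarrow> (nat \<Rightarrow> 'k \<Rightarrow> 'c \<Rightarrow> real) \<Rightarrow> nat \<Rightarrow> 'k \<Rightarrow> real list" where
  "observations s Y n k = map (\<lambda>i. Y i k (snd (s i))) (sample_times s n k)"

definition positive_definite_kernel_on :: "'c set \<Rightarrow> ('c \<Rightarrow> 'c \<Rightarrow> real) \<Rightarrow> bool" where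
  "positive_definite_kernel_on C \<Sigma> \<longleftrightarrow>
     (\<forall>c\<in>C. \<forall>c'\<in>C. \<Sigma> c c' = \<Sigma> c' c) \<and>
     (\<forall>a. (\<exists>c\<in>C. a c \<noteq> 0) \<longrightarrow> (\<Sum>c\<in>C. \<Sum>c'\<in>C. a c * \<Sigma> c c' * a c') > 0)"

definition gp_matrix :: "('c \<Rightarrow> 'c \<Rightarrow> real) \<Rightarrow> ('c \<Rightarrow> real) \<Rightarrow> 'c list \<Rightarrow> real mat" where
  "gp_matrix \<Sigma> \<sigma> D =
     Matrix.mat (length D) (length D) (\<lambda>(i, j). \<Sigma> (D ! i) (D ! j))
     + mat_diag (length D) (\<lambda>i. (\<sigma> (D ! i))\<^sup>2)"

(* Prior mean m, prior covariance \<Sigma>, noise standard deviation \<sigma>, design points D, data ys.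
   mat_inverse is option-valued; gp_matrix is invertible whenever the covariance matrix of D is
   positive semidefinite and \<sigma> does not vanish on D. *)
definition gp_posterior_mean ::
  "('c \<Rightarrow> real) \<Rightarrow> ('c \<Rightarrow> 'c \<Rightarrow> real) \<Rightarrow> ('c \<Rightarrow> real) \<Rightarrow> 'c list \<Rightarrow> real list \<Rightarrow> 'c \<Rightarrow> real" where
  "gp_posterior_mean m \<Sigma> \<sigma> D ys c =
     m c + scalar_prod (vec_of_list (map (\<Sigma> c) D))
       (the (mat_inverse (gp_matrix \<Sigma> \<sigma> D)) *\<^sub>v (vec_of_list ys - vec_of_list (map m D)))"

definition predicted_reward ::
  "('k \<Rightarrow> 'c \<Rightarrow> real) \<Rightarrow> ('k \<Rightarrow> 'c \<Rightarrow> 'c \<Rightarrow> real) \<Rightarrow> ('k \<Rightarrow> 'c \<Rightarrow> real) \<Rightarrow>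
   (nat \<Rightarrow> 'k \<times> 'c) \<Rightarrow> (nat \<Rightarrow> 'k \<Rightarrow> 'c \<Rightarrow> real) \<Rightarrow> nat \<Rightarrow> 'k \<Rightarrow> 'c \<Rightarrow> real" where
  "predicted_reward \<mu>0 \<Sigma>0 \<sigma> s Y n k c =
     gp_posterior_mean (\<mu>0 k) (\<Sigma>0 k) (\<sigma> k) (sampled_contexts s n k) (observations s Y n k) c"

(* Used both for the true rewards and for the predictions. For the predictions ties may occur;
   arg_max_on then picks one of the maximisers, depending only on the set of maximisers. *)
definition best_alternative :: "'k set \<Rightarrow> ('k \<Rightarrow> 'c \<Rightarrow> real) \<Rightarrow> 'c \<Rightarrow> 'k" where
  "best_alternative K G c = arg_max_on (\<lambda>k. G k c) K"

(* \<mu> n k c is the prediction after n samples, as a random variable on M. *)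
definition PCS ::
  "'a measure \<Rightarrow> 'k set \<Rightarrow> ('k \<Rightarrow> 'c \<Rightarrow> real) \<Rightarrow> (nat \<Rightarrow> 'k \<Rightarrow> 'c \<Rightarrow> 'a \<Rightarrow> real) \<Rightarrow> nat \<Rightarrow> 'c \<Rightarrow> real" where
  "PCS M K F \<mu> n c = measure M
     {\<omega> \<in> space M. best_alternative K (\<lambda>k c. \<mu> n k c \<omega>) c = best_alternative K F c}"

definition PFS_E ::
  "'a measure \<Rightarrow> 'k set \<Rightarrow> 'c set \<Rightarrow> ('c \<Rightarrow> real) \<Rightarrow> ('k \<Rightarrow> 'c \<Rightarrow> real) \<Rightarrow>
   (nat \<Rightarrow> 'k \<Rightarrow> 'c \<Rightarrow> 'a \<Rightarrow> real) \<Rightarrow> nat \<Rightarrow> real" where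
  "PFS_E M K C w F \<mu> n = 1 - (\<Sum>c\<in>C. w c * PCS M K F \<mu> n c)"

definition PFS_M ::
  "'a measure \<Rightarrow> 'k set \<Rightarrow> 'c set \<Rightarrow> ('k \<Rightarrow> 'c \<Rightarrow> real) \<Rightarrow>
   (nat \<Rightarrow> 'k \<Rightarrow> 'c \<Rightarrow> 'a \<Rightarrow> real) \<Rightarrow> nat \<Rightarrow> real" where
  "PFS_M M K C F \<mu> n = 1 - (MIN c\<in>C. PCS M K F \<mu> n c)"

end

theory Submission
  imports Defs "Jordan_Normal_Form.Determinant"
begin

text \<open>For a fixed alternative, the rows of the linear system behind the posterior mean that belong to
  one context add up to a single equation, which leaves
  \<open>(\<Sigma> + \<Lambda>) a = Ybar - m\<close> and \<open>\<mu>\<^sub>n = Ybar - \<Lambda> a\<close>, where \<open>Ybar\<close> are the sample averages, \<open>m\<close> is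
  the prior mean and \<open>\<Lambda>\<close> is diagonal with entries \<open>\<sigma>\<^sup>2 / N\<close>. Since \<open>\<Sigma>\<close> is positive definite,
  \<open>a\<close> is bounded as long as \<open>Ybar\<close> is, so the posterior mean differs from the sample average by
  \<open>O(1 / n)\<close> outside an event whose exponential rate is as large as we like. Hence only the Gaussian
  tails of differences of sample averages matter, the union over contexts and alternatives
  contributes only a constant factor, and the slowest decay wins.\<close>

subsection \<open>Gaussian tails\<close>

text \<open>The posterior means at one context mix the noise of all contexts through an inverse
  matrix, so instead of their exact law the proof uses a comparison, sample point by sample point,
  with averages, whose differences are exactly Gaussian. The comparison constant is itself random
  and grows with the noise. It is therefore used only where all averaged errors stay below a level
  \<open>L\<close>, and \<open>L\<close> is chosen after the target rate, so that the discarded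
  event decays at least that fast. What remains is a fixed slack \<open>\<delta>\<close> per
  prediction, which moves the threshold for a noise difference from the reward gap to the gap plus
  or minus \<open>2 * \<delta>\<close>; continuity of \<open>x^2 / (2 * V)\<close> in
  \<open>x\<close> removes it. Rates are carried as eventual bounds by
  \<open>exp (- r * real n)\<close> for every \<open>r\<close> strictly on one side of the claimed
  rate: the strict inequality leaves room for the constants of union bounds, weights and
  prefactors.\<close>

lemma normal_density_mono_shift:
  fixes x z \<tau> :: real
  assumes "x \<ge> 0" "z \<ge> x" "\<tau> > 0"
  shows "normal_density 0 \<tau> z \<le> exp (- x\<^sup>2 / (2 * \<tau>\<^sup>2)) * normal_density x \<tau> z"
proof -
  \<comment> \<open>This is the cross term of the square of \<open>x + (z - x)\<close>; dropping it
    splits the exponent into a constant and a Gaussian centred at \<open>x\<close>.\<close>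
  have "0 \<le> 2 * x * (z - x)"
    using assms by simp
  hence "z\<^sup>2 \<ge> x\<^sup>2 + (z - x)\<^sup>2"
    by (simp add: power2_eq_square algebra_simps)
  hence "- z\<^sup>2 / (2 * \<tau>\<^sup>2) \<le> - x\<^sup>2 / (2 * \<tau>\<^sup>2) + - (z - x)\<^sup>2 / (2 * \<tau>\<^sup>2)"
    using assms(3) by (simp add: field_simps)
  hence "exp (- z\<^sup>2 / (2 * \<tau>\<^sup>2)) \<le> exp (- x\<^sup>2 / (2 * \<tau>\<^sup>2)) * exp (- (z - x)\<^sup>2 / (2 * \<tau>\<^sup>2))"
    by (simp flip: exp_add)
  hence "1 / sqrt (2 * pi * \<tau>\<^sup>2) * exp (- z\<^sup>2 / (2 * \<tau>\<^sup>2))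
      \<le> 1 / sqrt (2 * pi * \<tau>\<^sup>2) * (exp (- x\<^sup>2 / (2 * \<tau>\<^sup>2)) * exp (- (z - x)\<^sup>2 / (2 * \<tau>\<^sup>2)))"
    by (rule mult_left_mono) auto
  thus ?thesis
    by (simp add: normal_density_def mult_ac)
qed

text \<open>Beyond \<open>x\<close> the density is at most
  \<open>exp (- x^2 / (2 * \<tau>^2))\<close> times the density recentred at \<open>x\<close>, whose
  total mass is one. This gives the Chernoff bound by a pointwise comparison.\<close>

lemma (in prob_space) normal_tail_upper:
  assumes X: "distributed M lborel X (normal_density 0 \<tau>)" and "\<tau> > 0" "x \<ge> 0"
  shows "prob {\<omega> \<in> space M. x \<le> X \<omega>} \<le> exp (- x\<^sup>2 / (2 * \<tau>\<^sup>2))"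
proof -
  have "emeasure M (X -` {x..} \<inter> space M)
      = (\<integral>\<^sup>+z. ennreal (normal_density 0 \<tau> z) * indicator {x..} z \<partial>lborel)"
    using X by (rule distributed_emeasure) simp
  also have "\<dots> \<le> (\<integral>\<^sup>+z. exp (- x\<^sup>2 / (2 * \<tau>\<^sup>2)) * normal_density x \<tau> z \<partial>lborel)"
    using normal_density_mono_shift[OF \<open>x \<ge> 0\<close> _ \<open>\<tau> > 0\<close>]
    by (intro nn_integral_mono) (auto split: split_indicator simp: ennreal_leI simp flip: ennreal_mult'')
  also have "\<dots> = ennreal (exp (- x\<^sup>2 / (2 * \<tau>\<^sup>2)) * 1)"
    using \<open>\<tau> > 0\<close> integral_normal_density[OF \<open>\<tau> > 0\<close>, of x]
      integrable_normal_density[OF \<open>\<tau> > 0\<close>, of x]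
    by (subst nn_integral_eq_integral) auto
  finally have "prob (X -` {x..} \<inter> space M) \<le> exp (- x\<^sup>2 / (2 * \<tau>\<^sup>2))"
    by (simp add: emeasure_eq_measure)
  thus ?thesis
    by (simp add: vimage_def Int_def conj_commute)
qed

text \<open>Only the mass of the interval from \<open>x\<close> to \<open>x + \<eta>\<close> is
  kept. As \<open>x \<ge> 0\<close>, the density is smallest at the right end, so length times that
  value is a lower bound.\<close>

lemma (in prob_space) normal_tail_lower:
  assumes X: "distributed M lborel X (normal_density 0 \<tau>)" and "\<tau> > 0" "x \<ge> 0" "\<eta> > 0"
  shows "prob {\<omega> \<in> space M. x < X \<omega>} \<ge> \<eta> * normal_density 0 \<tau> (x + \<eta>)"
proof -
  have mono: "normal_density 0 \<tau> (x + \<eta>) \<le> normal_density 0 \<tau> z" if "x < z" "z \<le> x + \<eta>" for z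
  proof -
    have "z\<^sup>2 \<le> (x + \<eta>)\<^sup>2"
      using that \<open>x \<ge> 0\<close> by (intro power_mono) auto
    thus ?thesis
      using \<open>\<tau> > 0\<close> by (auto simp: normal_density_def intro!: divide_right_mono)
  qed
  have "ennreal (\<eta> * normal_density 0 \<tau> (x + \<eta>))
      = (\<integral>\<^sup>+z. ennreal (normal_density 0 \<tau> (x + \<eta>)) * indicator {x<..x + \<eta>} z \<partial>lborel)"
    using \<open>\<eta> > 0\<close> by (simp add: nn_integral_cmult_indicator mult.commute flip: ennreal_mult)
  also have "\<dots> \<le> (\<integral>\<^sup>+z. ennreal (normal_density 0 \<tau> z) * indicator {x<..} z \<partial>lborel)"
    using mono by (intro nn_integral_mono) (auto split: split_indicator simp: ennreal_leI)
  also have "\<dots> = emeasure M (X -` {x<..} \<inter> space M)"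
    using X by (rule distributed_emeasure[symmetric]) simp
  finally have "\<eta> * normal_density 0 \<tau> (x + \<eta>) \<le> prob (X -` {x<..} \<inter> space M)"
    by (simp add: emeasure_eq_measure)
  thus ?thesis
    by (simp add: vimage_def Int_def conj_commute)
qed

lemma (in prob_space) weighted_sum_indep_normal:
  fixes X :: "'i \<Rightarrow> 'a \<Rightarrow> real"
  assumes "finite I" "I \<noteq> {}" and ind: "indep_vars (\<lambda>_. borel) X I"
    and "\<And>i. i \<in> I \<Longrightarrow> \<sigma> i > 0" "\<And>i. i \<in> I \<Longrightarrow> a i \<noteq> 0"
    and "\<And>i. i \<in> I \<Longrightarrow> distributed M lborel (X i) (normal_density 0 (\<sigma> i))"
  shows "distributed M lborel (\<lambda>\<omega>. \<Sum>i\<in>I. a i * X i \<omega>)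
           (normal_density 0 (sqrt (\<Sum>i\<in>I. (a i)\<^sup>2 * (\<sigma> i)\<^sup>2)))"
proof -
  have "distributed M lborel (\<lambda>\<omega>. a i * X i \<omega>) (normal_density 0 (\<bar>a i\<bar> * \<sigma> i))" if "i \<in> I" for i
    using normal_density_affine[of "X i" 0 "\<sigma> i" "a i" 0] assms that by simp
  moreover have "indep_vars (\<lambda>_. borel) (\<lambda>i \<omega>. a i * X i \<omega>) I"
    using ind by (rule indep_vars_compose2) simp
  ultimately have "distributed M lborel (\<lambda>\<omega>. \<Sum>i\<in>I. a i * X i \<omega>)
      (normal_density (\<Sum>i\<in>I. 0) (sqrt (\<Sum>i\<in>I. (\<bar>a i\<bar> * \<sigma> i)\<^sup>2)))"
    using assms by (intro sum_indep_normal) auto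
  thus ?thesis
    by (simp add: power_mult_distrib)
qed

text \<open>The exponent is \<open>real n\<close> times a quantity tending to
  \<open>x^2 / (2 * V)\<close>, hence eventually above \<open>r\<close>. Asking only for the limit
  of \<open>n\<close> times the variance lets the sampling fractions converge rather than be
  constant.\<close>

lemma (in prob_space) normal_tail_upper_rate:
  assumes X: "\<forall>\<^sub>F n in sequentially. \<tau> n > 0 \<and> distributed M lborel (X n) (normal_density 0 (\<tau> n))"
    and lim: "(\<lambda>n. real n * (\<tau> n)\<^sup>2) \<longlonglongrightarrow> V" and "V > 0" "x \<ge> 0" and r: "r < x\<^sup>2 / (2 * V)"
  shows "\<forall>\<^sub>F n in sequentially. prob {\<omega> \<in> space M. x \<le> X n \<omega>} \<le> exp (- r * real n)"
proof -
  have "(\<lambda>n. x\<^sup>2 / (2 * (real n * (\<tau> n)\<^sup>2))) \<longlonglongrightarrow> x\<^sup>2 / (2 * V)"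
    using \<open>V > 0\<close> by (intro tendsto_intros lim) auto
  hence "\<forall>\<^sub>F n in sequentially. r < x\<^sup>2 / (2 * (real n * (\<tau> n)\<^sup>2))"
    using r by (rule order_tendstoD)
  with X eventually_gt_at_top[of 0] show ?thesis
  proof eventually_elim
    case (elim n)
    hence "prob {\<omega> \<in> space M. x \<le> X n \<omega>} \<le> exp (- x\<^sup>2 / (2 * (\<tau> n)\<^sup>2))"
      using \<open>x \<ge> 0\<close> by (intro normal_tail_upper) auto
    also have "r * real n \<le> x\<^sup>2 / (2 * (\<tau> n)\<^sup>2)"
      using elim by (simp add: field_simps)
    hence "exp (- x\<^sup>2 / (2 * (\<tau> n)\<^sup>2)) \<le> exp (- r * real n)"
      by simp
    finally show ?case .
  qed
qed

lemma (in prob_space) normal_tail_lower_rate: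
  assumes X: "\<forall>\<^sub>F n in sequentially. \<tau> n > 0 \<and> distributed M lborel (X n) (normal_density 0 (\<tau> n))"
    and lim: "(\<lambda>n. real n * (\<tau> n)\<^sup>2) \<longlonglongrightarrow> V" and "V > 0" "x \<ge> 0" and r: "r > x\<^sup>2 / (2 * V)"
  shows "\<forall>\<^sub>F n in sequentially. exp (- r * real n) \<le> prob {\<omega> \<in> space M. x < X n \<omega>}"
proof -
  \<comment> \<open>The window width \<open>\<eta>\<close> is fixed before \<open>n\<close> grows:
    small enough that evaluating the density at \<open>x + \<eta>\<close> still costs less than
    \<open>r\<close>.\<close>
  have "((\<lambda>\<eta>. (x + \<eta>)\<^sup>2 / (2 * V)) \<longlongrightarrow> (x + 0)\<^sup>2 / (2 * V)) (at_right 0)"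
    using \<open>V > 0\<close> by (intro tendsto_intros) auto
  hence "\<forall>\<^sub>F \<eta> in at_right 0. (x + \<eta>)\<^sup>2 / (2 * V) < r"
    using r by (intro order_tendstoD) simp_all
  moreover have "\<forall>\<^sub>F \<eta> in at_right 0. \<eta> > (0::real)"
    by (simp add: eventually_at_right_less)
  ultimately have "\<forall>\<^sub>F \<eta> in at_right 0. (x + \<eta>)\<^sup>2 / (2 * V) < r \<and> \<eta> > 0"
    by eventually_elim simp
  then obtain \<eta> where \<eta>: "(x + \<eta>)\<^sup>2 / (2 * V) < r" "\<eta> > 0"
    by (metis (mono_tags, lifting) eventually_happens trivial_limit_at_right_real)
  have "(\<lambda>n. (x + \<eta>)\<^sup>2 / (2 * (real n * (\<tau> n)\<^sup>2))) \<longlonglongrightarrow> (x + \<eta>)\<^sup>2 / (2 * V)"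
    using \<open>V > 0\<close> by (intro tendsto_intros lim) auto
  \<comment> \<open>The density prefactor involves the variance itself, which tends to 0. Scaling it
    by \<open>real n\<close> only weakens the lower bound once \<open>n \<ge> 1\<close>, and makes
    the logarithm converge.\<close>
  moreover have "(\<lambda>n. ln (2 * pi * (real n * (\<tau> n)\<^sup>2)) / (2 * real n)) \<longlonglongrightarrow> 0"
  proof -
    have "(\<lambda>n. ln (2 * pi * (real n * (\<tau> n)\<^sup>2))) \<longlonglongrightarrow> ln (2 * pi * V)"
      using \<open>V > 0\<close> by (intro tendsto_intros lim) auto
    moreover have "filterlim (\<lambda>n. 2 * real n) at_infinity sequentially"
      by (intro tendsto_mult_filterlim_at_infinity[OF tendsto_const]
          filterlim_at_top_imp_at_infinity filterlim_real_sequentially) simp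
    ultimately show ?thesis
      by (rule tendsto_divide_0)
  qed
  moreover have "(\<lambda>n. ln \<eta> / real n) \<longlonglongrightarrow> 0"
    by (rule lim_const_over_n)
  ultimately have "(\<lambda>n. (x + \<eta>)\<^sup>2 / (2 * (real n * (\<tau> n)\<^sup>2)) + ln (2 * pi * (real n * (\<tau> n)\<^sup>2)) / (2 * real n)
        - ln \<eta> / real n) \<longlonglongrightarrow> (x + \<eta>)\<^sup>2 / (2 * V) + 0 - 0"
    by (intro tendsto_diff tendsto_add)
  hence "\<forall>\<^sub>F n in sequentially. (x + \<eta>)\<^sup>2 / (2 * (real n * (\<tau> n)\<^sup>2))
      + ln (2 * pi * (real n * (\<tau> n)\<^sup>2)) / (2 * real n) - ln \<eta> / real n < r"
    using \<eta>(1) by (intro order_tendstoD) simp_all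
  with X eventually_ge_at_top[of 1] show ?thesis
  proof eventually_elim
    case (elim n)
    define T where "T = (\<tau> n)\<^sup>2"
    have T: "T > 0" "sqrt T = \<tau> n" using elim by (simp_all add: T_def)
    have "real n * ((x + \<eta>)\<^sup>2 / (2 * (real n * T)) + ln (2 * pi * (real n * T)) / (2 * real n) - ln \<eta> / real n)
        \<le> real n * r"
      using elim by (intro mult_left_mono) (simp_all add: T_def)
    also have "real n * ((x + \<eta>)\<^sup>2 / (2 * (real n * T)) + ln (2 * pi * (real n * T)) / (2 * real n) - ln \<eta> / real n)
        = (x + \<eta>)\<^sup>2 / (2 * T) + ln (2 * pi * (real n * T)) / 2 - ln \<eta>"
      using elim T by (simp add: field_simps)
    finally have "- r * real n \<le> - (x + \<eta>)\<^sup>2 / (2 * T) - ln (2 * pi * (real n * T)) / 2 + ln \<eta>"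
      by (simp add: mult.commute)
    also have "ln (2 * pi * (real n * T)) \<ge> ln (2 * pi * T)"
      using elim T by (intro ln_mono) (auto simp: mult_le_cancel_right1)
    hence "- (x + \<eta>)\<^sup>2 / (2 * T) - ln (2 * pi * (real n * T)) / 2 + ln \<eta>
        \<le> - (x + \<eta>)\<^sup>2 / (2 * T) - ln (2 * pi * T) / 2 + ln \<eta>"
      by simp
    also have "\<dots> = ln (\<eta> * normal_density 0 (\<tau> n) (x + \<eta>))"
      using T \<eta> elim
      by (simp add: normal_density_def ln_mult ln_div ln_sqrt T_def)
    finally have "exp (- r * real n) \<le> \<eta> * normal_density 0 (\<tau> n) (x + \<eta>)"
      using \<eta> elim by (subst (asm) ln_ge_iff) (auto intro!: mult_pos_pos normal_density_pos)
    also have "\<dots> \<le> prob {\<omega> \<in> space M. x < X n \<omega>}"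
      using elim \<open>x \<ge> 0\<close> \<eta> by (intro normal_tail_lower) auto
    finally show ?case .
  qed
qed

subsection \<open>Posterior means and sample averages\<close>

text \<open>The constant is the minimum of the quadratic form on the unit sphere, attained by
  compactness and positive by definiteness; homogeneity extends the bound to all
  \<open>a\<close>.\<close>

lemma positive_definite_kernel_coercive:
  fixes \<Sigma> :: "'c \<Rightarrow> 'c \<Rightarrow> real"
  assumes "finite C" and pd: "positive_definite_kernel_on C \<Sigma>"
  obtains \<alpha> where "\<alpha> > 0"
    "\<And>a. \<alpha> * (\<Sum>c\<in>C. (a c)\<^sup>2) \<le> (\<Sum>c\<in>C. \<Sum>c'\<in>C. a c * \<Sigma> c c' * a c')"
proof -
  define q where "q a = (\<Sum>c\<in>C. \<Sum>c'\<in>C. a c * \<Sigma> c c' * a c')" for a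
  \<comment> \<open>Coefficient families are total functions, so the coordinates outside
    \<open>C\<close> are pinned to 0; a product of compact sets is then compact by Tychonoff. For
    empty \<open>C\<close> the sphere is empty and any positive constant serves.\<close>
  define S :: "('c \<Rightarrow> real) set"
    where "S = Pi\<^sub>E UNIV (\<lambda>c. if c \<in> C then {-1..1} else {0}) \<inter> {a. (\<Sum>c\<in>C. (a c)\<^sup>2) = 1}"
  have coord: "continuous_on T (\<lambda>a. a c)" for T and c :: 'c and a :: "'c \<Rightarrow> real"
    by (rule continuous_on_subset[OF continuous_on_product_coordinates]) simp
  have "compact (Pi\<^sub>E UNIV (\<lambda>c. if c \<in> C then {-1..1} else {0::real}))"
    using compactin_PiE[of "\<lambda>_. euclidean" UNIV "\<lambda>c. if c \<in> C then {-1..1} else {0::real}"]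
    by (simp add: euclidean_product_topology)
  moreover have "closed {a :: 'c \<Rightarrow> real. (\<Sum>c\<in>C. (a c)\<^sup>2) = 1}"
    by (intro closed_Collect_eq continuous_intros coord)
  ultimately have "compact S"
    unfolding S_def by (rule compact_Int_closed)
  obtain \<alpha> where \<alpha>: "\<alpha> > 0" "\<And>b. b \<in> S \<Longrightarrow> \<alpha> \<le> q b"
  proof (cases "S = {}")
    case False
    have "continuous_on S q"
      unfolding q_def by (intro continuous_intros coord)
    then obtain b where b: "b \<in> S" "\<And>b'. b' \<in> S \<Longrightarrow> q b \<le> q b'"
      using continuous_attains_inf[OF \<open>compact S\<close> False] by blast
    have "\<exists>c\<in>C. b c \<noteq> 0"
    proof (rule ccontr)
      assume "\<not> ?thesis"
      hence "(\<Sum>c\<in>C. (b c)\<^sup>2) = 0"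
        by simp
      with b(1) show False
        by (simp add: S_def)
    qed
    hence "q b > 0"
      using pd by (simp add: positive_definite_kernel_on_def q_def)
    with b show ?thesis
      using that by blast
  qed (use that[of 1] in auto)
  show thesis
  proof (rule that[OF \<alpha>(1)])
    fix a :: "'c \<Rightarrow> real"
    define N where "N = sqrt (\<Sum>c\<in>C. (a c)\<^sup>2)"
    have N2: "N\<^sup>2 = (\<Sum>c\<in>C. (a c)\<^sup>2)"
      by (simp add: N_def sum_nonneg)
    show "\<alpha> * (\<Sum>c\<in>C. (a c)\<^sup>2) \<le> (\<Sum>c\<in>C. \<Sum>c'\<in>C. a c * \<Sigma> c c' * a c')"
    proof (cases "N = 0")
      case True
      hence "\<forall>c\<in>C. a c = 0"
        using N2 \<open>finite C\<close> by (simp add: sum_nonneg_eq_0_iff)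
      thus ?thesis
        by simp
    next
      case False
      hence "N > 0"
        by (simp add: N_def less_le sum_nonneg)
      define b where "b c = (if c \<in> C then a c / N else 0)" for c
      have "\<bar>a c\<bar> \<le> N" if "c \<in> C" for c
      proof -
        have "(a c)\<^sup>2 \<le> N\<^sup>2"
          unfolding N2 using \<open>finite C\<close> that by (intro member_le_sum) auto
        thus ?thesis
          using \<open>N > 0\<close> by (simp add: abs_le_square_iff[symmetric])
      qed
      hence "b c \<in> {-1..1}" if "c \<in> C" for c
        using \<open>N > 0\<close> that by (fastforce simp: b_def abs_le_iff field_simps)
      moreover have "(\<Sum>c\<in>C. (b c)\<^sup>2) = (\<Sum>c\<in>C. (a c)\<^sup>2) / N\<^sup>2"
        by (simp add: b_def power_divide sum_divide_distrib)
      ultimately have "b \<in> S"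
        using False by (auto simp: S_def N2[symmetric] b_def)
      hence "N\<^sup>2 * \<alpha> \<le> N\<^sup>2 * q b"
        by (intro mult_left_mono \<alpha>) auto
      also have "N\<^sup>2 * q b = q a"
        unfolding q_def sum_distrib_left
        using False by (intro sum.cong refl) (simp add: b_def field_simps power2_eq_square)
      finally show ?thesis
        by (simp add: q_def N2 mult.commute)
    qed
  qed
qed

definition positions :: "'b list \<Rightarrow> 'b \<Rightarrow> nat set" where
  "positions xs x = {i. i < length xs \<and> xs ! i = x}"

lemma finite_positions [simp]: "finite (positions xs x)"
  by (simp add: positions_def)

lemma card_positions_pos: "x \<in> set xs \<Longrightarrow> card (positions xs x) > 0"
  by (auto simp: card_gt_0_iff positions_def in_set_conv_nth)

lemma sum_positions:
  fixes g :: "'b \<Rightarrow> real"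
  assumes "finite C" "set D \<subseteq> C"
  shows "(\<Sum>j<length D. g (D ! j) * x j) = (\<Sum>c\<in>C. g c * (\<Sum>j\<in>positions D c. x j))"
proof -
  have "(\<Sum>j<length D. g (D ! j) * x j)
      = (\<Sum>c\<in>C. \<Sum>j\<in>{j\<in>{..<length D}. D ! j = c}. g (D ! j) * x j)"
    using assms by (intro sum.group[symmetric]) auto
  also have "\<dots> = (\<Sum>c\<in>C. g c * (\<Sum>j\<in>positions D c. x j))"
    unfolding sum_distrib_left by (intro sum.cong) (auto simp: positions_def)
  finally show ?thesis .
qed

lemma gp_matrix_carrier [simp]: "gp_matrix \<Sigma> \<sigma> D \<in> carrier_mat (length D) (length D)"
  by (simp add: gp_matrix_def)

lemma gp_matrix_mult_vec:
  assumes "x \<in> carrier_vec (length D)" "i < length D"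
  shows "vec_index (gp_matrix \<Sigma> \<sigma> D *\<^sub>v x) i =
    (\<Sum>j<length D. \<Sigma> (D ! i) (D ! j) * vec_index x j) + (\<sigma> (D ! i))\<^sup>2 * vec_index x i"
proof -
  have "vec_index (gp_matrix \<Sigma> \<sigma> D *\<^sub>v x) i =
    (\<Sum>j<length D. (\<Sigma> (D ! i) (D ! j) + (if i = j then (\<sigma> (D ! j))\<^sup>2 else 0)) * vec_index x j)"
    using assms by (simp add: gp_matrix_def mat_diag_def scalar_prod_def atLeast0LessThan)
  also have "\<dots> = (\<Sum>j<length D. \<Sigma> (D ! i) (D ! j) * vec_index x j)
      + (\<Sum>j<length D. if i = j then (\<sigma> (D ! j))\<^sup>2 * vec_index x j else 0)"
    unfolding sum.distrib[symmetric] by (intro sum.cong) (auto simp: algebra_simps)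
  finally show ?thesis
    using assms by simp
qed

text \<open>Testing the system against \<open>a\<close> itself gives
  \<open>\<alpha> |a|^2 \<le> a . v\<close>, and Young's inequality absorbs half of the left side.
  The nonnegative term with \<open>\<Lambda>\<close> is dropped, so the bound is uniform in the
  sample counts that \<open>\<Lambda>\<close> will encode.\<close>

lemma coercive_system_bound:
  fixes a v :: "'c \<Rightarrow> real"
  assumes "finite C" "\<alpha> > 0"
    and coercive: "\<And>a. \<alpha> * (\<Sum>c\<in>C. (a c)\<^sup>2) \<le> (\<Sum>c\<in>C. \<Sum>c'\<in>C. a c * \<Sigma> c c' * a c')"
    and "\<And>c. c \<in> C \<Longrightarrow> \<Lambda> c \<ge> 0"
    and system: "\<And>c. c \<in> C \<Longrightarrow> (\<Sum>c'\<in>C. \<Sigma> c c' * a c') + \<Lambda> c * a c = v c"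
    and "c \<in> C"
  shows "\<bar>a c\<bar> \<le> sqrt (\<Sum>c\<in>C. (v c)\<^sup>2) / \<alpha>"
proof -
  have young: "a c * v c \<le> \<alpha> / 2 * (a c)\<^sup>2 + (v c)\<^sup>2 / (2 * \<alpha>)" for c
  proof -
    have "0 \<le> (\<alpha> * a c - v c)\<^sup>2 / (2 * \<alpha>)"
      using \<open>\<alpha> > 0\<close> by simp
    thus ?thesis
      using \<open>\<alpha> > 0\<close> by (simp add: field_simps power2_eq_square)
  qed
  have "\<alpha> * (\<Sum>c\<in>C. (a c)\<^sup>2) \<le> (\<Sum>c\<in>C. \<Sum>c'\<in>C. a c * \<Sigma> c c' * a c')"
    by (rule coercive)
  also have "\<dots> \<le> (\<Sum>c\<in>C. a c * v c)"
  proof (rule sum_mono)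
    fix c assume "c \<in> C"
    have "(\<Sum>c'\<in>C. a c * \<Sigma> c c' * a c') \<le> a c * (\<Sum>c'\<in>C. \<Sigma> c c' * a c') + \<Lambda> c * (a c)\<^sup>2"
      using assms(4)[OF \<open>c \<in> C\<close>] by (simp add: sum_distrib_left mult.assoc)
    also have "\<dots> = a c * v c"
      using system[OF \<open>c \<in> C\<close>] by (simp add: power2_eq_square algebra_simps flip: system[OF \<open>c \<in> C\<close>])
    finally show "(\<Sum>c'\<in>C. a c * \<Sigma> c c' * a c') \<le> a c * v c" .
  qed
  also have "\<dots> \<le> (\<Sum>c\<in>C. \<alpha> / 2 * (a c)\<^sup>2 + (v c)\<^sup>2 / (2 * \<alpha>))"
    by (intro sum_mono young)
  also have "\<dots> = \<alpha> / 2 * (\<Sum>c\<in>C. (a c)\<^sup>2) + (\<Sum>c\<in>C. (v c)\<^sup>2) / (2 * \<alpha>)"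
    by (simp add: sum.distrib sum_distrib_left sum_divide_distrib)
  finally have "\<alpha>\<^sup>2 * (\<Sum>c\<in>C. (a c)\<^sup>2) \<le> (\<Sum>c\<in>C. (v c)\<^sup>2)"
    using \<open>\<alpha> > 0\<close> by (simp add: field_simps power2_eq_square)
  moreover have "(a c)\<^sup>2 \<le> (\<Sum>c\<in>C. (a c)\<^sup>2)"
    using \<open>finite C\<close> \<open>c \<in> C\<close> by (intro member_le_sum) auto
  ultimately have "(\<alpha> * a c)\<^sup>2 \<le> (\<Sum>c\<in>C. (v c)\<^sup>2)"
    using \<open>\<alpha> > 0\<close> by (smt (verit) mult_left_mono power_mult_distrib zero_le_power2)
  hence "\<bar>\<alpha> * a c\<bar> \<le> sqrt (\<Sum>c\<in>C. (v c)\<^sup>2)"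
    using real_sqrt_le_mono by fastforce
  thus ?thesis
    using \<open>\<alpha> > 0\<close> by (simp add: abs_mult field_simps)
qed

text \<open>Rows of samples taken at the same context share their covariance part, which sees
  \<open>x\<close> only through the group sums \<open>a\<close>. Dividing by the group size averages
  the right-hand side and leaves the variance of a sample average on the diagonal.\<close>

lemma gp_system_aggregate:
  fixes x :: "real Matrix.vec"
  assumes "finite C" "set D = C" "c \<in> C"
    and x: "x \<in> carrier_vec (length D)" "gp_matrix \<Sigma> \<sigma> D *\<^sub>v x = u"
  defines "a \<equiv> \<lambda>c. \<Sum>j\<in>positions D c. vec_index x j"
  shows "(\<Sum>c'\<in>C. \<Sigma> c c' * a c') + (\<sigma> c)\<^sup>2 / card (positions D c) * a c
      = (\<Sum>i\<in>positions D c. vec_index u i) / card (positions D c)"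
proof -
  have card: "card (positions D c) > 0"
    using assms by (intro card_positions_pos) simp
  have "(\<Sum>i\<in>positions D c. vec_index u i)
      = (\<Sum>i\<in>positions D c. (\<Sum>c'\<in>C. \<Sigma> c c' * a c') + (\<sigma> c)\<^sup>2 * vec_index x i)"
  proof (rule sum.cong)
    fix i assume "i \<in> positions D c"
    hence i: "i < length D" "D ! i = c"
      by (auto simp: positions_def)
    show "vec_index u i = (\<Sum>c'\<in>C. \<Sigma> c c' * a c') + (\<sigma> c)\<^sup>2 * vec_index x i"
      using gp_matrix_mult_vec[OF x(1) i(1), of \<Sigma> \<sigma>] sum_positions[of C D "\<Sigma> c" "vec_index x"] assms(1,2)
      by (simp add: a_def i(2) x(2))
  qed simp
  also have "\<dots> = card (positions D c) * (\<Sum>c'\<in>C. \<Sigma> c c' * a c') + (\<sigma> c)\<^sup>2 * a c"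
    by (simp add: sum.distrib a_def sum_distrib_left)
  finally show ?thesis
    using card by (auto simp: add_divide_distrib)
qed

text \<open>With repeated contexts the covariance matrix of \<open>D\<close> alone may be singular.
  For \<open>x\<close> in the kernel of the full matrix the aggregated system has right-hand side 0,
  so all group sums vanish; each row then reduces to \<open>\<sigma>^2\<close> times one entry of
  \<open>x\<close>, and the noise makes that entry 0.\<close>

lemma gp_matrix_invertible:
  assumes "finite C" "set D = C" "\<alpha> > 0"
    and coercive: "\<And>a. \<alpha> * (\<Sum>c\<in>C. (a c)\<^sup>2) \<le> (\<Sum>c\<in>C. \<Sum>c'\<in>C. a c * \<Sigma> c c' * a c')"
    and \<sigma>: "\<And>c. c \<in> C \<Longrightarrow> \<sigma> c > 0"
  obtains B where "mat_inverse (gp_matrix \<Sigma> \<sigma> D) = Some B" "B \<in> carrier_mat (length D) (length D)"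
    "gp_matrix \<Sigma> \<sigma> D * B = 1\<^sub>m (length D)"
proof -
  let ?A = "gp_matrix \<Sigma> \<sigma> D" and ?n = "length D"
  have "x = 0\<^sub>v ?n" if x: "x \<in> carrier_vec ?n" "?A *\<^sub>v x = 0\<^sub>v ?n" for x
  proof (rule eq_vecI)
    define a where "a c = (\<Sum>j\<in>positions D c. vec_index x j)" for c
    have zero: "(\<Sum>i\<in>positions D c. vec_index (0\<^sub>v ?n :: real Matrix.vec) i) = 0" for c
      by (intro sum.neutral) (auto simp: positions_def)
    have "(\<Sum>c'\<in>C. \<Sigma> c c' * a c') + (\<sigma> c)\<^sup>2 / card (positions D c) * a c = 0" if "c \<in> C" for c
      using gp_system_aggregate[OF assms(1,2) that x] unfolding a_def zero by simp
    hence a: "a c = 0" if "c \<in> C" for c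
      using coercive_system_bound[OF assms(1,3) coercive, of "\<lambda>c. (\<sigma> c)\<^sup>2 / card (positions D c)" a "\<lambda>_. 0" c] that
      by simp
    fix i assume i: "i < dim_vec (0\<^sub>v ?n :: real Matrix.vec)"
    have "(\<Sum>j<?n. \<Sigma> (D ! i) (D ! j) * vec_index x j) = 0"
      using sum_positions[of C D "\<Sigma> (D ! i)" "vec_index x"] assms(1,2) a
      by (simp add: a_def[symmetric])
    hence "(\<sigma> (D ! i))\<^sup>2 * vec_index x i = 0"
      using gp_matrix_mult_vec[OF x(1), of i \<Sigma> \<sigma>] x(2) i by simp
    moreover have "\<sigma> (D ! i) > 0"
      using i assms(2) by (intro \<sigma>) auto
    ultimately show "vec_index x i = vec_index (0\<^sub>v ?n) i"
      using i by simp
  qed (use x in auto)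
  hence "Determinant.det ?A \<noteq> 0"
    using det_0_iff_vec_prod_zero_field[of ?A ?n] by auto
  hence "?A \<in> Units (ring_mat TYPE(real) ?n ())"
    by (rule det_non_zero_imp_unit[rotated]) simp
  then obtain B where "mat_inverse ?A = Some B"
    using mat_inverse(1)[of ?A ?n "()"] by fastforce
  thus thesis
    using that mat_inverse(2)[of ?A ?n B] by auto
qed

text \<open>Deterministic, for every data list \<open>ys\<close>: randomness will enter only through
  \<open>avg\<close>. The averages of all contexts occur on the right because the prior correlates
  them.\<close>

lemma gp_posterior_mean_near_average:
  assumes "finite C" "set D = C" "\<alpha> > 0" and len: "length ys = length D"
    and coercive: "\<And>a. \<alpha> * (\<Sum>c\<in>C. (a c)\<^sup>2) \<le> (\<Sum>c\<in>C. \<Sum>c'\<in>C. a c * \<Sigma> c c' * a c')"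
    and \<sigma>: "\<And>c. c \<in> C \<Longrightarrow> \<sigma> c > 0" and "c \<in> C"
  defines "avg \<equiv> \<lambda>c. (\<Sum>i\<in>positions D c. ys ! i) / card (positions D c)"
  shows "\<bar>gp_posterior_mean m \<Sigma> \<sigma> D ys c - avg c\<bar>
    \<le> (\<sigma> c)\<^sup>2 / card (positions D c) * (sqrt (\<Sum>c\<in>C. (avg c - m c)\<^sup>2) / \<alpha>)"
proof -
  let ?A = "gp_matrix \<Sigma> \<sigma> D" and ?n = "length D"
  obtain B where B: "mat_inverse ?A = Some B" "B \<in> carrier_mat ?n ?n" "?A * B = 1\<^sub>m ?n"
    by (rule gp_matrix_invertible[OF assms(1-3) coercive \<sigma>])
  define u where "u = vec_of_list ys - vec_of_list (map m D)"
  define x where "x = B *\<^sub>v u"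
  have u: "u \<in> carrier_vec ?n"
    using len by (intro carrier_vecI) (simp add: u_def)
  hence x: "x \<in> carrier_vec ?n"
    unfolding x_def by (rule mult_mat_vec_carrier[OF B(2)])
  have "?A *\<^sub>v x = (?A * B) *\<^sub>v u"
    unfolding x_def by (rule assoc_mult_mat_vec[OF gp_matrix_carrier B(2) u, symmetric])
  hence Ax: "?A *\<^sub>v x = u"
    using B(3) u by simp
  define a where "a c = (\<Sum>j\<in>positions D c. vec_index x j)" for c
  have card: "card (positions D c) > 0" if "c \<in> C" for c
    using that assms(2) by (intro card_positions_pos) simp
  have system: "(\<Sum>c'\<in>C. \<Sigma> c c' * a c') + (\<sigma> c)\<^sup>2 / card (positions D c) * a c = avg c - m c"
    if "c \<in> C" for c
  proof -
    have "(\<Sum>i\<in>positions D c. vec_index u i) = (\<Sum>i\<in>positions D c. ys ! i - m c)"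
      using len by (intro sum.cong) (auto simp: positions_def u_def vec_of_list_index)
    thus ?thesis
      using gp_system_aggregate[OF assms(1,2) that x Ax] card[OF that]
      by (auto simp: a_def avg_def sum_subtractf diff_divide_distrib)
  qed
  have "gp_posterior_mean m \<Sigma> \<sigma> D ys c = m c + (\<Sum>j<?n. \<Sigma> c (D ! j) * vec_index x j)"
    unfolding gp_posterior_mean_def B(1) option.sel u_def[symmetric] x_def[symmetric]
    using x by (simp add: scalar_prod_def atLeast0LessThan vec_of_list_index)
  also have "\<dots> = m c + (\<Sum>c'\<in>C. \<Sigma> c c' * a c')"
    using sum_positions[of C D "\<Sigma> c" "vec_index x"] assms(1,2) by (simp add: a_def)
  also have "\<dots> = avg c - (\<sigma> c)\<^sup>2 / card (positions D c) * a c"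
    using system[OF \<open>c \<in> C\<close>] by simp
  finally have "\<bar>gp_posterior_mean m \<Sigma> \<sigma> D ys c - avg c\<bar> = (\<sigma> c)\<^sup>2 / card (positions D c) * \<bar>a c\<bar>"
    by (simp add: abs_mult)
  also have "\<dots> \<le> (\<sigma> c)\<^sup>2 / card (positions D c) * (sqrt (\<Sum>c\<in>C. (avg c - m c)\<^sup>2) / \<alpha>)"
    by (intro mult_left_mono coercive_system_bound[OF assms(1,3) coercive _ system \<open>c \<in> C\<close>]) auto
  finally show ?thesis .
qed

text \<open>The predictor indexes data by list position, the noise is indexed by sampling time; the
  \<open>j\<close>-th entry of the list of times is the bijection between the two.\<close>

lemma sum_positions_sampled_contexts:
  fixes Y :: "nat \<Rightarrow> 'k \<Rightarrow> 'c \<Rightarrow> real"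
  shows "(\<Sum>j\<in>positions (sampled_contexts s n k) c. observations s Y n k ! j)
      = (\<Sum>i | i < n \<and> s i = (k, c). Y i k c)"
    and "card (positions (sampled_contexts s n k) c) = num_samples s n k c"
proof -
  let ?T = "sample_times s n k" and ?P = "positions (sampled_contexts s n k) c"
  have "distinct ?T"
    by (simp add: sample_times_def)
  hence "inj_on ((!) ?T) ?P"
    by (auto simp: inj_on_def positions_def sampled_contexts_def nth_eq_iff_index_eq)
  moreover have "(!) ?T ` ?P = {i. i < n \<and> s i = (k, c)}"
  proof (intro equalityI subsetI)
    fix i assume "i \<in> {i. i < n \<and> s i = (k, c)}"
    moreover from this have "i \<in> set ?T"
      by (simp add: sample_times_def)
    then obtain j where "j < length ?T" "?T ! j = i"
      by (auto simp: in_set_conv_nth)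
    ultimately show "i \<in> (!) ?T ` ?P"
      by (force simp: positions_def sampled_contexts_def)
  next
    fix i assume "i \<in> (!) ?T ` ?P"
    then obtain j where "j < length ?T" "i = ?T ! j" "snd (s i) = c"
      by (auto simp: positions_def sampled_contexts_def)
    moreover from this have "i \<in> set ?T"
      by simp
    ultimately show "i \<in> {i. i < n \<and> s i = (k, c)}"
      by (auto simp: sample_times_def prod_eq_iff)
  qed
  ultimately have bij: "bij_betw ((!) ?T) ?P {i. i < n \<and> s i = (k, c)}"
    by (simp add: bij_betw_def)
  show "card ?P = num_samples s n k c"
    unfolding num_samples_def by (rule bij_betw_same_card[OF bij])
  have "(\<Sum>j\<in>?P. observations s Y n k ! j) = (\<Sum>j\<in>?P. Y (?T ! j) k c)"
    by (intro sum.cong) (auto simp: positions_def sampled_contexts_def observations_def)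
  also have "\<dots> = (\<Sum>i | i < n \<and> s i = (k, c). Y i k c)"
    by (rule sum.reindex_bij_betw[OF bij])
  finally show "(\<Sum>j\<in>?P. observations s Y n k ! j) = (\<Sum>i | i < n \<and> s i = (k, c). Y i k c)" .
qed

lemma predicted_reward_near_average:
  fixes Y :: "nat \<Rightarrow> 'k \<Rightarrow> 'c \<Rightarrow> real"
  assumes "finite C" "\<alpha> > 0" "c \<in> C" "\<And>i. s i \<in> K \<times> C" "\<And>c. c \<in> C \<Longrightarrow> num_samples s n k c > 0"
    and coercive: "\<And>a. \<alpha> * (\<Sum>c\<in>C. (a c)\<^sup>2) \<le> (\<Sum>c\<in>C. \<Sum>c'\<in>C. a c * \<Sigma>0 k c c' * a c')"
    and \<sigma>: "\<And>c. c \<in> C \<Longrightarrow> \<sigma> k c > 0"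
  defines "avg \<equiv> \<lambda>c. (\<Sum>i | i < n \<and> s i = (k, c). Y i k c) / num_samples s n k c"
  shows "\<bar>predicted_reward \<mu>0 \<Sigma>0 \<sigma> s Y n k c - avg c\<bar>
    \<le> (\<sigma> k c)\<^sup>2 / num_samples s n k c * (sqrt (\<Sum>c\<in>C. (avg c - \<mu>0 k c)\<^sup>2) / \<alpha>)"
proof -
  let ?D = "sampled_contexts s n k" and ?ys = "observations s Y n k"
  have "set ?D = C"
  proof (intro equalityI subsetI)
    fix c assume "c \<in> C"
    hence "card (positions ?D c) > 0"
      using assms(5) by (simp add: sum_positions_sampled_contexts)
    then obtain j where "j \<in> positions ?D c"
      by (metis card_gt_0_iff ex_in_conv)
    thus "c \<in> set ?D"
      by (auto simp: positions_def)
  next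
    fix c assume "c \<in> set ?D"
    then obtain i where "c = snd (s i)"
      by (auto simp: sampled_contexts_def)
    thus "c \<in> C"
      using assms(4)[of i] by (auto simp: mem_Times_iff)
  qed
  moreover have "length ?ys = length ?D"
    by (simp add: observations_def sampled_contexts_def)
  ultimately show ?thesis
    using gp_posterior_mean_near_average[OF assms(1) _ assms(2) _ coercive \<sigma> assms(3),
        where D = ?D and ys = ?ys and m = "\<mu>0 k"]
    by (simp add: predicted_reward_def avg_def sum_positions_sampled_contexts)
qed

subsection \<open>Measurability of the selection\<close>

text \<open>Exposes the selection as a fixed choice function applied to the set of maximisers, which
  is what makes ties harmless for measurability.\<close>

lemma best_alternative_eq_some:
  "best_alternative K G c = (SOME k. k \<in> {k\<in>K. \<forall>k'\<in>K. G k' c \<le> G k c})"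
  by (simp add: best_alternative_def arg_max_on_def arg_max_def is_arg_max_linorder Ball_def)

lemma best_alternative_maximal:
  assumes "finite K" "K \<noteq> {}"
  shows "best_alternative K G c \<in> K"
    and "k \<in> K \<Longrightarrow> G k c \<le> G (best_alternative K G c) c"
proof -
  have "Max ((\<lambda>k. G k c) ` K) \<in> (\<lambda>k. G k c) ` K"
    using assms by (intro Max_in) auto
  then obtain k0 where "k0 \<in> K" "G k0 c = Max ((\<lambda>k. G k c) ` K)"
    by force
  hence "k0 \<in> {k\<in>K. \<forall>k'\<in>K. G k' c \<le> G k c}"
    using assms by auto
  hence *: "best_alternative K G c \<in> {k\<in>K. \<forall>k'\<in>K. G k' c \<le> G k c}"
    unfolding best_alternative_eq_some by (rule someI)
  from * show "best_alternative K G c \<in> K"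
    by simp
  from * show "k \<in> K \<Longrightarrow> G k c \<le> G (best_alternative K G c) c"
    by blast
qed

text \<open>The choice function is arbitrary, but it acts on the finitely many subsets of
  \<open>K\<close>. The event is thus a finite union of events that prescribe the whole set of
  maximisers.\<close>

lemma measurable_best_alternative:
  fixes G :: "'a \<Rightarrow> 'k \<Rightarrow> 'c \<Rightarrow> real"
  assumes "finite K" and [measurable]: "\<And>k. k \<in> K \<Longrightarrow> (\<lambda>\<omega>. G \<omega> k c) \<in> borel_measurable M"
  shows "{\<omega> \<in> space M. best_alternative K (G \<omega>) c = b} \<in> sets M"
proof -
  define A where "A \<omega> = {k\<in>K. \<forall>k'\<in>K. G \<omega> k' c \<le> G \<omega> k c}" for \<omega>
  have "A \<omega> \<subseteq> K" for \<omega>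
    by (auto simp: A_def)
  hence "{\<omega> \<in> space M. best_alternative K (G \<omega>) c = b}
      = (\<Union>S\<in>{S\<in>Pow K. (SOME k. k \<in> S) = b}. {\<omega> \<in> space M. A \<omega> = S})"
    unfolding best_alternative_eq_some A_def[symmetric] by auto
  also have "\<dots> = (\<Union>S\<in>{S\<in>Pow K. (SOME k. k \<in> S) = b}.
      {\<omega> \<in> space M. \<forall>k\<in>K. k \<in> S \<longleftrightarrow> (\<forall>k'\<in>K. G \<omega> k' c \<le> G \<omega> k c)})"
    by (intro SUP_cong refl) (auto simp: A_def)
  also have "\<dots> \<in> sets M"
    using \<open>finite K\<close> by (intro sets.finite_UN) (auto intro!: sets.sets_Collect_finite_All')
  finally show ?thesis .
qed

lemma measurable_gp_posterior_mean:
  assumes len: "\<And>\<omega>. length (ys \<omega>) = length D"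
    and ys [measurable]: "\<And>j. j < length D \<Longrightarrow> (\<lambda>\<omega>. ys \<omega> ! j) \<in> borel_measurable M"
  shows "(\<lambda>\<omega>. gp_posterior_mean m \<Sigma> \<sigma> D (ys \<omega>) c) \<in> borel_measurable M"
proof -
  \<comment> \<open>For a fixed design this matrix is constant in \<open>\<omega>\<close>, so the
    prediction is affine in the data. Without an inverse \<open>B\<close> is an unspecified matrix,
    hence the sum up to \<open>dim_row B\<close> below.\<close>
  define B where "B = the (mat_inverse (gp_matrix \<Sigma> \<sigma> D))"
  have "gp_posterior_mean m \<Sigma> \<sigma> D (ys \<omega>) c = m c +
      (\<Sum>i<dim_row B. vec_index (vec_of_list (map (\<Sigma> c) D)) i *
        (\<Sum>j<length D. vec_index (Matrix.row B i) j * (ys \<omega> ! j - m (D ! j))))" for \<omega>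
    by (simp add: gp_posterior_mean_def B_def[symmetric] scalar_prod_def atLeast0LessThan len
        vec_of_list_index)
  thus ?thesis
    by (simp del: vec_of_list_map)
qed

subsection \<open>Exponential rates\<close>

text \<open>Since \<open>a\<close> is eventually below \<open>(r' - r) * real n\<close>, hence below
  its exponential, any constant factor is paid for by an arbitrarily small loss of rate.\<close>

lemma exp_rate_absorb_constant:
  fixes a r r' :: real
  assumes "r < r'"
  shows "\<forall>\<^sub>F n in sequentially. a * exp (- r' * real n) \<le> exp (- r * real n)"
  using eventually_ge_at_top[of "nat \<lceil>a / (r' - r)\<rceil>"]
proof eventually_elim
  case (elim n)
  hence "a / (r' - r) \<le> real n"
    by linarith
  hence "a \<le> (r' - r) * real n"
    using assms by (simp add: field_simps)
  also have "\<dots> \<le> exp ((r' - r) * real n)"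
    using exp_ge_add_one_self[of "(r' - r) * real n"] by linarith
  finally have "a * exp (- r' * real n) \<le> exp ((r' - r) * real n) * exp (- r' * real n)"
    by (rule mult_right_mono) simp
  also have "\<dots> = exp (- r * real n)"
    by (simp add: algebra_simps flip: exp_add)
  finally show ?case .
qed

lemma exp_rate_limit:
  fixes a :: "nat \<Rightarrow> real"
  assumes upper: "\<And>r. r < R \<Longrightarrow> \<forall>\<^sub>F n in sequentially. a n \<le> exp (- r * real n)"
    and lower: "\<And>r. r > R \<Longrightarrow> \<forall>\<^sub>F n in sequentially. exp (- r * real n) \<le> a n"
  shows "(\<lambda>n. 1 / real n * ln (a n)) \<longlonglongrightarrow> - R"
proof (rule order_tendstoI)
  fix x assume "x < - R"
  then obtain r where r: "R < r" "r < - x"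
    using dense[of R "- x"] by auto
  from lower[OF r(1)] eventually_gt_at_top[of 0]
  show "\<forall>\<^sub>F n in sequentially. x < 1 / real n * ln (a n)"
  proof eventually_elim
    case (elim n)
    hence "- r * real n \<le> ln (a n)"
      by (metis exp_gt_zero ln_exp ln_mono)
    moreover have "x * real n < - r * real n"
      using r elim by (intro mult_strict_right_mono) auto
    ultimately show ?case
      using elim by (simp add: field_simps)
  qed
next
  fix x assume "x > - R"
  then obtain r where r: "- x < r" "r < R"
    using dense[of "- x" R] by auto
  \<comment> \<open>The lower bound, here at the arbitrary rate \<open>R + 1\<close>, only serves to
    make \<open>a n\<close> positive before its logarithm is compared.\<close>
  from upper[OF r(2)] lower[of "R + 1", simplified] eventually_gt_at_top[of 0]
  show "\<forall>\<^sub>F n in sequentially. x > 1 / real n * ln (a n)"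
  proof eventually_elim
    case (elim n)
    have "0 < a n"
      using elim(2) by (rule less_le_trans[OF exp_gt_zero])
    hence "ln (a n) \<le> - r * real n"
      using elim by (metis exp_le_cancel_iff exp_ln)
    moreover have "x * real n > - r * real n"
      using r elim by (intro mult_strict_right_mono) auto
    ultimately show ?case
      using elim by (simp add: field_simps)
  qed
qed

locale gp_selection = prob_space M for M :: "'a measure" +
  fixes K :: "'k set" and C :: "'c set"
    and F \<sigma> p \<mu>0 :: "'k \<Rightarrow> 'c \<Rightarrow> real"
    and \<epsilon> y :: "nat \<Rightarrow> 'k \<Rightarrow> 'c \<Rightarrow> 'a \<Rightarrow> real"
    and s :: "nat \<Rightarrow> 'k \<times> 'c"
    and \<Sigma>0 :: "'k \<Rightarrow> 'c \<Rightarrow> 'c \<Rightarrow> real"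
    and \<mu> :: "nat \<Rightarrow> 'k \<Rightarrow> 'c \<Rightarrow> 'a \<Rightarrow> real"
    and best :: "'c \<Rightarrow> 'k"
  assumes finite_K: "finite K" and card_K: "card K \<ge> 2"
    and finite_C: "finite C" and C_nonempty: "C \<noteq> {}"
    and \<sigma>_pos: "\<And>k c. k \<in> K \<Longrightarrow> c \<in> C \<Longrightarrow> \<sigma> k c > 0"
    and y_eq: "\<And>i k c \<omega>. k \<in> K \<Longrightarrow> c \<in> C \<Longrightarrow> \<omega> \<in> space M \<Longrightarrow> y i k c \<omega> = F k c + \<epsilon> i k c \<omega>"
    and \<epsilon>_normal: "\<And>i k c. k \<in> K \<Longrightarrow> c \<in> C \<Longrightarrow>
      distributed M lborel (\<epsilon> i k c) (normal_density 0 (\<sigma> k c))"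
    and \<epsilon>_indep: "indep_vars (\<lambda>_. borel) (\<lambda>(i, k, c). \<epsilon> i k c) (UNIV \<times> K \<times> C)"
    and unique_best: "\<And>c. c \<in> C \<Longrightarrow> \<exists>!k. is_arg_max (\<lambda>k. F k c) (\<lambda>k. k \<in> K) k"
    and best_eq: "\<And>c. c \<in> C \<Longrightarrow> best c = best_alternative K F c"
    and s_mem: "\<And>i. s i \<in> K \<times> C"
    and p_pos: "\<And>k c. k \<in> K \<Longrightarrow> c \<in> C \<Longrightarrow> p k c > 0"
    and p_lim: "\<And>k c. k \<in> K \<Longrightarrow> c \<in> C \<Longrightarrow> (\<lambda>n. real (num_samples s n k c) / real n) \<longlonglongrightarrow> p k c"
    and \<Sigma>0_pd: "\<And>k. k \<in> K \<Longrightarrow> positive_definite_kernel_on C (\<Sigma>0 k)"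
    and \<mu>_eq: "\<And>n k c \<omega>. k \<in> K \<Longrightarrow> c \<in> C \<Longrightarrow> \<omega> \<in> space M \<Longrightarrow>
      \<mu> n k c \<omega> = predicted_reward \<mu>0 \<Sigma>0 \<sigma> s (\<lambda>i k c. y i k c \<omega>) n k c"
begin

lemma s_components: "fst (s i) \<in> K" "snd (s i) \<in> C"
  using s_mem[of i] by (simp_all add: mem_Times_iff)

lemma K_nonempty: "K \<noteq> {}"
  using card_K by auto

lemma best_mem: "c \<in> C \<Longrightarrow> best c \<in> K"
  using best_alternative_maximal(1)[OF finite_K K_nonempty] by (simp add: best_eq)

lemma gap_pos:
  assumes "c \<in> C" "k \<in> K" "k \<noteq> best c"
  shows "F k c < F (best c) c"
proof (rule ccontr)
  have max: "F k' c \<le> F (best c) c" if "k' \<in> K" for k'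
    using best_alternative_maximal(2)[OF finite_K K_nonempty that] assms(1) by (simp add: best_eq)
  assume "\<not> ?thesis"
  hence "is_arg_max (\<lambda>k. F k c) (\<lambda>k. k \<in> K) k"
    using max assms(2) by (force simp: is_arg_max_linorder)
  moreover have "is_arg_max (\<lambda>k. F k c) (\<lambda>k. k \<in> K) (best c)"
    using max best_mem[OF assms(1)] by (simp add: is_arg_max_linorder)
  ultimately show False
    using unique_best[OF assms(1)] assms(3) by blast
qed

lemma \<epsilon>_measurable [measurable]: "k \<in> K \<Longrightarrow> c \<in> C \<Longrightarrow> \<epsilon> i k c \<in> borel_measurable M"
  using distributed_measurable[OF \<epsilon>_normal] by simp

section \<open>Averaged noise and its Gaussian law\<close>

definition sampled :: "nat \<Rightarrow> 'k \<Rightarrow> 'c \<Rightarrow> nat set" where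
  "sampled n k c = {i. i < n \<and> s i = (k, c)}"

text \<open>The centred sample average: once \<open>(k, c)\<close> has been sampled,
  \<open>F k c + err n k c\<close> is the \<open>Ybar\<close> of the overview.\<close>

definition err :: "nat \<Rightarrow> 'k \<Rightarrow> 'c \<Rightarrow> 'a \<Rightarrow> real" where
  "err n k c \<omega> = (\<Sum>i\<in>sampled n k c. \<epsilon> i k c \<omega>) / num_samples s n k c"

lemma finite_sampled [simp]: "finite (sampled n k c)"
  by (simp add: sampled_def)

lemma card_sampled: "card (sampled n k c) = num_samples s n k c"
  by (simp add: sampled_def num_samples_def)

lemma err_measurable [measurable]: "k \<in> K \<Longrightarrow> c \<in> C \<Longrightarrow> err n k c \<in> borel_measurable M"
  unfolding err_def by simp

text \<open>Exactly one noise variable is observed at each time, so \<open>i\<close> maps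
  injectively to \<open>(i, s i)\<close> and the observed noises form a subfamily of the independent
  family.\<close>

lemma noise_sum_normal:
  assumes "finite I" "I \<noteq> {}" "\<And>i. i \<in> I \<Longrightarrow> a i \<noteq> 0"
  shows "distributed M lborel (\<lambda>\<omega>. \<Sum>i\<in>I. a i * \<epsilon> i (fst (s i)) (snd (s i)) \<omega>)
           (normal_density 0 (sqrt (\<Sum>i\<in>I. (a i)\<^sup>2 * (\<sigma> (fst (s i)) (snd (s i)))\<^sup>2)))"
proof -
  let ?J = "(\<lambda>i. (i, s i)) ` I"
  have "indep_vars (\<lambda>_. borel) (\<lambda>(i, k, c). \<epsilon> i k c) ?J"
    by (intro indep_vars_subset[OF \<epsilon>_indep] image_subsetI) (simp add: s_mem)
  moreover have "distributed M lborel ((\<lambda>(i, k, c). \<epsilon> i k c) j)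
        (normal_density 0 ((\<lambda>(i, k, c). \<sigma> k c) j))"
    and "(\<lambda>(i, k, c). \<sigma> k c) j > 0" if j: "j \<in> ?J" for j
  proof -
    obtain i where "j = (i, s i)"
      using j by blast
    thus "distributed M lborel ((\<lambda>(i, k, c). \<epsilon> i k c) j)
        (normal_density 0 ((\<lambda>(i, k, c). \<sigma> k c) j))" "(\<lambda>(i, k, c). \<sigma> k c) j > 0"
      using \<epsilon>_normal[OF s_components] \<sigma>_pos[OF s_components] by (simp_all add: split_beta)
  qed
  ultimately have "distributed M lborel (\<lambda>\<omega>. \<Sum>j\<in>?J. a (fst j) * (\<lambda>(i, k, c). \<epsilon> i k c) j \<omega>)
      (normal_density 0 (sqrt (\<Sum>j\<in>?J. (a (fst j))\<^sup>2 * ((\<lambda>(i, k, c). \<sigma> k c) j)\<^sup>2)))"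
    using assms by (intro weighted_sum_indep_normal) auto
  moreover have "inj_on (\<lambda>i. (i, s i)) I"
    by (simp add: inj_on_def)
  ultimately show ?thesis
    by (simp add: sum.reindex split_beta)
qed

text \<open>The factor \<open>b\<close> will be 1 or -1, so that one statement covers both tails of
  the averaged noise.\<close>

lemma err_normal:
  assumes "k \<in> K" "c \<in> C" "num_samples s n k c > 0" "b \<noteq> 0"
  shows "distributed M lborel (\<lambda>\<omega>. b * err n k c \<omega>)
    (normal_density 0 (sqrt (b\<^sup>2 * (\<sigma> k c)\<^sup>2 / num_samples s n k c)))"
proof -
  let ?N = "real (num_samples s n k c)"
  have "distributed M lborel (\<lambda>\<omega>. \<Sum>i\<in>sampled n k c. b / ?N * \<epsilon> i (fst (s i)) (snd (s i)) \<omega>)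
      (normal_density 0 (sqrt (\<Sum>i\<in>sampled n k c. (b / ?N)\<^sup>2 * (\<sigma> (fst (s i)) (snd (s i)))\<^sup>2)))"
    using assms(3,4) by (intro noise_sum_normal) (auto simp flip: card_sampled)
  also have "(\<lambda>\<omega>. \<Sum>i\<in>sampled n k c. b / ?N * \<epsilon> i (fst (s i)) (snd (s i)) \<omega>) = (\<lambda>\<omega>. b * err n k c \<omega>)"
    by (simp add: err_def sampled_def sum_distrib_left sum_divide_distrib)
  also have "(\<Sum>i\<in>sampled n k c. (b / ?N)\<^sup>2 * (\<sigma> (fst (s i)) (snd (s i)))\<^sup>2)
      = (\<Sum>i\<in>sampled n k c. (b / ?N)\<^sup>2 * (\<sigma> k c)\<^sup>2)"
    by (intro sum.cong) (auto simp: sampled_def)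
  also have "\<dots> = b\<^sup>2 * (\<sigma> k c)\<^sup>2 / ?N"
    using assms(3) by (simp add: card_sampled field_simps power2_eq_square)
  finally show ?thesis .
qed

lemma err_diff_normal:
  assumes "k \<in> K" "k' \<in> K" "k \<noteq> k'" "c \<in> C" "num_samples s n k c > 0" "num_samples s n k' c > 0"
  shows "distributed M lborel (\<lambda>\<omega>. err n k c \<omega> - err n k' c \<omega>)
    (normal_density 0 (sqrt ((\<sigma> k' c)\<^sup>2 / num_samples s n k' c + (\<sigma> k c)\<^sup>2 / num_samples s n k c)))"
proof -
  let ?N = "\<lambda>k. real (num_samples s n k c)"
  let ?I = "sampled n k c \<union> sampled n k' c"
  \<comment> \<open>The difference is written as one weighted sum over disjoint sets of times, so
    that independence of the two averages comes with the joint independence of the noise.\<close>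
  define a where "a i = (if fst (s i) = k then 1 / ?N k else - 1 / ?N k')" for i
  have split: "(\<Sum>i\<in>?I. f i) = (\<Sum>i\<in>sampled n k c. f i) + (\<Sum>i\<in>sampled n k' c. f i)" for f :: "nat \<Rightarrow> real"
    using assms(3) by (intro sum.union_disjoint) (auto simp: sampled_def)
  have "distributed M lborel (\<lambda>\<omega>. \<Sum>i\<in>?I. a i * \<epsilon> i (fst (s i)) (snd (s i)) \<omega>)
      (normal_density 0 (sqrt (\<Sum>i\<in>?I. (a i)\<^sup>2 * (\<sigma> (fst (s i)) (snd (s i)))\<^sup>2)))"
    using assms(5,6) by (intro noise_sum_normal) (auto simp: a_def simp flip: card_sampled)
  also have "(\<lambda>\<omega>. \<Sum>i\<in>?I. a i * \<epsilon> i (fst (s i)) (snd (s i)) \<omega>) = (\<lambda>\<omega>. err n k c \<omega> - err n k' c \<omega>)"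
    using assms(3) unfolding split
    by (simp add: err_def sampled_def a_def sum_distrib_left sum_divide_distrib sum_negf)
  also have "(\<Sum>i\<in>?I. (a i)\<^sup>2 * (\<sigma> (fst (s i)) (snd (s i)))\<^sup>2)
      = (\<Sum>i\<in>sampled n k c. (1 / ?N k)\<^sup>2 * (\<sigma> k c)\<^sup>2) + (\<Sum>i\<in>sampled n k' c. (1 / ?N k')\<^sup>2 * (\<sigma> k' c)\<^sup>2)"
    using assms(3) unfolding split
    by (intro arg_cong2[where f = "(+)"] sum.cong) (auto simp: sampled_def a_def power_divide)
  also have "\<dots> = (\<sigma> k' c)\<^sup>2 / ?N k' + (\<sigma> k c)\<^sup>2 / ?N k"
    using assms(5,6) by (simp add: card_sampled field_simps power2_eq_square)
  finally show ?thesis .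
qed

section \<open>Sample counts, the exceptional event and the prediction error\<close>

lemma samples_ratio_lim:
  assumes "k \<in> K" "c \<in> C"
  shows "(\<lambda>n. real n * (v / num_samples s n k c)) \<longlonglongrightarrow> v / p k c"
proof -
  have "(\<lambda>n. v / (num_samples s n k c / real n)) \<longlonglongrightarrow> v / p k c"
    using p_pos[OF assms] by (intro tendsto_intros p_lim assms) simp
  thus ?thesis
    by (simp add: mult.commute)
qed

lemma inverse_samples_lim:
  assumes "k \<in> K" "c \<in> C"
  shows "(\<lambda>n. v / num_samples s n k c) \<longlonglongrightarrow> 0"
proof -
  have "(\<lambda>n. real n * (v / num_samples s n k c) * inverse (real n)) \<longlonglongrightarrow> v / p k c * 0"
    by (intro tendsto_mult samples_ratio_lim assms lim_inverse_n)
  hence "(\<lambda>n. real n * (v / num_samples s n k c) * inverse (real n)) \<longlonglongrightarrow> 0"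
    by simp
  moreover have "\<forall>\<^sub>F n in sequentially. real n * (v / num_samples s n k c) * inverse (real n) = v / num_samples s n k c"
    using eventually_gt_at_top[of 0] by eventually_elim simp
  ultimately show ?thesis
    by (rule Lim_transform_eventually)
qed

lemma eventually_sampled:
  "\<forall>\<^sub>F n in sequentially. \<forall>k\<in>K. \<forall>c\<in>C. num_samples s n k c > 0"
proof (intro eventually_ball_finite finite_K finite_C ballI)
  fix k c assume "k \<in> K" "c \<in> C"
  hence "\<forall>\<^sub>F n in sequentially. 0 < real (num_samples s n k c) / real n"
    using order_tendstoD(1)[OF p_lim p_pos] by blast
  thus "\<forall>\<^sub>F n in sequentially. num_samples s n k c > 0"
    by eventually_elim (auto simp: zero_less_divide_iff)
qed

text \<open>The exceptional event to be discarded; \<open>L\<close> stays fixed while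
  \<open>n\<close> grows.\<close>

definition large_error :: "nat \<Rightarrow> real \<Rightarrow> 'a set" where
  "large_error n L = {\<omega> \<in> space M. \<exists>k\<in>K. \<exists>c\<in>C. L \<le> \<bar>err n k c \<omega>\<bar>}"

lemma large_error_sets [measurable]: "large_error n L \<in> sets M"
proof -
  have "large_error n L = (\<Union>k\<in>K. \<Union>c\<in>C. {\<omega> \<in> space M. L \<le> \<bar>err n k c \<omega>\<bar>})"
    by (auto simp: large_error_def)
  also have "\<dots> \<in> sets M"
    by (intro sets.finite_UN finite_K finite_C) measurable
  finally show ?thesis .
qed

lemma signed_err_tail_rate:
  assumes "k \<in> K" "c \<in> C" "\<bar>b\<bar> = 1" "L \<ge> 0" "r < L\<^sup>2 / (2 * ((\<sigma> k c)\<^sup>2 / p k c))"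
  shows "\<forall>\<^sub>F n in sequentially. prob {\<omega> \<in> space M. L \<le> b * err n k c \<omega>} \<le> exp (- r * real n)"
proof (rule normal_tail_upper_rate[OF _ _ _ assms(4,5)])
  have "b\<^sup>2 = 1"
    using assms(3) by (metis one_power2 power2_abs)
  have "b \<noteq> 0"
    using assms(3) by auto
  show "\<forall>\<^sub>F n in sequentially. sqrt (b\<^sup>2 * (\<sigma> k c)\<^sup>2 / num_samples s n k c) > 0 \<and>
      distributed M lborel (\<lambda>\<omega>. b * err n k c \<omega>)
        (normal_density 0 (sqrt (b\<^sup>2 * (\<sigma> k c)\<^sup>2 / num_samples s n k c)))"
    using eventually_sampled
  proof eventually_elim
    case (elim n)
    thus ?case
      using err_normal[OF assms(1,2), of n b] \<open>b \<noteq> 0\<close> \<sigma>_pos[OF assms(1,2)] assms(1,2) by simp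
  qed
  show "(\<lambda>n. real n * (sqrt (b\<^sup>2 * (\<sigma> k c)\<^sup>2 / num_samples s n k c))\<^sup>2) \<longlonglongrightarrow> (\<sigma> k c)\<^sup>2 / p k c"
    using samples_ratio_lim[OF assms(1,2), of "(\<sigma> k c)\<^sup>2"] by (simp add: \<open>b\<^sup>2 = 1\<close>)
  show "(\<sigma> k c)\<^sup>2 / p k c > 0"
    using \<sigma>_pos[OF assms(1,2)] p_pos[OF assms(1,2)] by simp
qed

text \<open>The Gaussian rate of exceeding \<open>L\<close> grows without bound in \<open>L\<close>,
  so some \<open>L\<close> beats any prescribed \<open>r\<close> for all finitely many pairs at
  once. Aiming at \<open>r + 1\<close> leaves room for the union bound.\<close>

lemma large_error_rate:
  obtains L where "\<forall>\<^sub>F n in sequentially. prob (large_error n L) \<le> exp (- r * real n)"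
proof -
  have "\<forall>\<^sub>F L in at_top. r + 1 < L\<^sup>2 / (2 * ((\<sigma> k c)\<^sup>2 / p k c))" if "k \<in> K" "c \<in> C" for k c
  proof -
    define V where "V = 2 * ((\<sigma> k c)\<^sup>2 / p k c)"
    have "V > 0"
      using \<sigma>_pos[OF that] p_pos[OF that] by (simp add: V_def)
    show ?thesis
      \<comment> \<open>Beyond 1 one has \<open>L \<le> L^2\<close>, so a threshold linear in
        \<open>(r + 1) * V\<close> is enough.\<close>
      unfolding V_def[symmetric] using eventually_gt_at_top[of "max 1 ((r + 1) * V)"]
    proof eventually_elim
      case (elim L)
      hence "(r + 1) * V < L" "L \<le> L\<^sup>2"
        by (auto simp: power2_eq_square)
      thus ?case
        using \<open>V > 0\<close> by (simp add: field_simps)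
    qed
  qed
  hence "\<forall>\<^sub>F L in at_top. \<forall>k\<in>K. \<forall>c\<in>C. r + 1 < L\<^sup>2 / (2 * ((\<sigma> k c)\<^sup>2 / p k c))"
    by (intro eventually_ball_finite finite_K finite_C ballI)
  then obtain L where L: "L \<ge> 0" "\<And>k c. k \<in> K \<Longrightarrow> c \<in> C \<Longrightarrow> r + 1 < L\<^sup>2 / (2 * ((\<sigma> k c)\<^sup>2 / p k c))"
    using eventually_happens[OF eventually_conj[OF _ eventually_ge_at_top[of 0]]] trivial_limit_at_top_linorder by blast
  let ?ev = "\<lambda>n k c b. {\<omega> \<in> space M. L \<le> b * err n k c \<omega>}"
  let ?I = "K \<times> C \<times> {1, -1 :: real}"
  have "\<forall>\<^sub>F n in sequentially. prob (?ev n k c b) \<le> exp (- (r + 1) * real n)"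
    if "(k, c, b) \<in> ?I" for k c b
    using that L by (intro signed_err_tail_rate) auto
  hence "\<forall>\<^sub>F n in sequentially. \<forall>(k, c, b)\<in>?I. prob (?ev n k c b) \<le> exp (- (r + 1) * real n)"
    using finite_K finite_C by (intro eventually_ball_finite) auto
  moreover have "\<forall>\<^sub>F n in sequentially. card ?I * exp (- (r + 1) * real n) \<le> exp (- r * real n)"
    by (rule exp_rate_absorb_constant) simp
  ultimately have "\<forall>\<^sub>F n in sequentially. prob (large_error n L) \<le> exp (- r * real n)"
  proof eventually_elim
    case (elim n)
    have "large_error n L \<subseteq> (\<Union>(k, c, b)\<in>?I. ?ev n k c b)"
      by (fastforce simp: large_error_def abs_if split: if_splits)
    hence "prob (large_error n L) \<le> prob (\<Union>(k, c, b)\<in>?I. ?ev n k c b)"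
      using finite_K finite_C by (intro finite_measure_mono sets.finite_UN) auto
    also have "\<dots> \<le> (\<Sum>(k, c, b)\<in>?I. prob (?ev n k c b))"
      unfolding split_beta using finite_K finite_C by (intro finite_measure_subadditive_finite) auto
    also have "\<dots> \<le> (\<Sum>i\<in>?I. exp (- (r + 1) * real n))"
      using elim(1) by (intro sum_mono) auto
    finally show ?case
      using elim(2) by simp
  qed
  thus thesis
    by (rule that)
qed

text \<open>Off the exceptional event the square root in the comparison bound is at most a constant
  free of \<open>n\<close> and \<open>\<omega>\<close>, and its factor \<open>\<sigma>^2 / N\<close>
  tends to 0. Hence one threshold for \<open>n\<close> works for all remaining sample
  points.\<close>

lemma \<mu>_near_average:
  assumes "\<delta> > 0"
  shows "\<forall>\<^sub>F n in sequentially. \<forall>k\<in>K. \<forall>c\<in>C. \<forall>\<omega>\<in>space M - large_error n L.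
    \<bar>\<mu> n k c \<omega> - (F k c + err n k c \<omega>)\<bar> \<le> \<delta>"
proof (intro eventually_ball_finite finite_K finite_C ballI)
  fix k c assume k: "k \<in> K" and c: "c \<in> C"
  obtain \<alpha> where \<alpha>: "\<alpha> > 0"
    "\<And>a. \<alpha> * (\<Sum>c\<in>C. (a c)\<^sup>2) \<le> (\<Sum>c\<in>C. \<Sum>c'\<in>C. a c * \<Sigma>0 k c c' * a c')"
    using positive_definite_kernel_coercive[OF finite_C \<Sigma>0_pd[OF k]] by blast
  \<comment> \<open>Worst case of the distance between averages and prior mean when every averaged
    error is below \<open>L\<close>.\<close>
  define Q where "Q = sqrt (\<Sum>c\<in>C. (\<bar>F k c - \<mu>0 k c\<bar> + L)\<^sup>2) / \<alpha>"
  have "(\<lambda>n. (\<sigma> k c)\<^sup>2 / num_samples s n k c * Q) \<longlonglongrightarrow> 0 * Q"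
    by (intro tendsto_mult inverse_samples_lim k c tendsto_const)
  hence "\<forall>\<^sub>F n in sequentially. (\<sigma> k c)\<^sup>2 / num_samples s n k c * Q < \<delta>"
    using \<open>\<delta> > 0\<close> by (intro order_tendstoD) simp_all
  with eventually_sampled
  show "\<forall>\<^sub>F n in sequentially. \<forall>\<omega>\<in>space M - large_error n L. \<bar>\<mu> n k c \<omega> - (F k c + err n k c \<omega>)\<bar> \<le> \<delta>"
  proof eventually_elim
    case (elim n)
    show ?case
    proof
      fix \<omega> assume \<omega>: "\<omega> \<in> space M - large_error n L"
      have avg: "(\<Sum>i | i < n \<and> s i = (k, c). y i k c \<omega>) / num_samples s n k c = F k c + err n k c \<omega>"
        if "c \<in> C" for c
      proof -
        have "(\<Sum>i | i < n \<and> s i = (k, c). y i k c \<omega>) = (\<Sum>i\<in>sampled n k c. F k c + \<epsilon> i k c \<omega>)"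
          using \<omega> k that by (auto simp: sampled_def y_eq)
        moreover have "num_samples s n k c > 0"
          using elim(1) k that by blast
        ultimately show ?thesis
          by (simp add: sum.distrib card_sampled err_def add_divide_distrib)
      qed
      have "\<bar>\<mu> n k c \<omega> - (F k c + err n k c \<omega>)\<bar>
          \<le> (\<sigma> k c)\<^sup>2 / num_samples s n k c * (sqrt (\<Sum>c\<in>C. (F k c + err n k c \<omega> - \<mu>0 k c)\<^sup>2) / \<alpha>)"
        using predicted_reward_near_average[of C \<alpha> c s K n k \<Sigma>0 \<sigma> \<mu>0 "\<lambda>i k c. y i k c \<omega>",
            OF finite_C \<alpha>(1) c s_mem _ \<alpha>(2) \<sigma>_pos[OF k]]
          elim(1) k c \<omega> by (simp add: avg \<mu>_eq cong: sum.cong)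
      also have "\<dots> \<le> (\<sigma> k c)\<^sup>2 / num_samples s n k c * Q"
        unfolding Q_def
      proof (intro mult_left_mono divide_right_mono real_sqrt_le_mono sum_mono)
        fix c assume "c \<in> C"
        hence "\<bar>err n k c \<omega>\<bar> < L"
          using \<omega> k by (auto simp: large_error_def not_le)
        hence "\<bar>F k c + err n k c \<omega> - \<mu>0 k c\<bar> \<le> \<bar>\<bar>F k c - \<mu>0 k c\<bar> + L\<bar>"
          by linarith
        thus "(F k c + err n k c \<omega> - \<mu>0 k c)\<^sup>2 \<le> (\<bar>F k c - \<mu>0 k c\<bar> + L)\<^sup>2"
          by (simp only: abs_le_square_iff)
      qed (use \<alpha>(1) in auto)
      finally show "\<bar>\<mu> n k c \<omega> - (F k c + err n k c \<omega>)\<bar> \<le> \<delta>"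
        using elim(2) by linarith
    qed
  qed
qed

section \<open>Comparing one alternative with the best one\<close>

definition pair_variance :: "'k \<Rightarrow> 'c \<Rightarrow> real" where
  "pair_variance k c = (\<sigma> (best c) c)\<^sup>2 / p (best c) c + (\<sigma> k c)\<^sup>2 / p k c"

text \<open>The Gaussian rate function \<open>x^2 / (2 * V)\<close> at the reward gap, where for
  \<open>k\<close> other than \<open>best c\<close> the denominator uses the limit of
  \<open>n\<close> times the variance of the difference of the two averaged errors.\<close>

definition pair_rate :: "'k \<Rightarrow> 'c \<Rightarrow> real" where
  "pair_rate k c = (F (best c) c - F k c)\<^sup>2 / (2 * pair_variance k c)"

lemma pair_variance_pos:
  assumes "c \<in> C" "k \<in> K"
  shows "pair_variance k c > 0"
  using \<sigma>_pos[OF assms(2,1)] p_pos[OF assms(2,1)]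
    \<sigma>_pos[OF best_mem[OF assms(1)] assms(1)] p_pos[OF best_mem[OF assms(1)] assms(1)]
  by (simp add: pair_variance_def add_pos_pos)

text \<open>The threshold \<open>x\<close> is left free because it will be the reward gap shifted by
  the prediction slack.\<close>

lemma
  assumes "c \<in> C" "k \<in> K" "k \<noteq> best c" "x \<ge> 0"
  shows err_diff_upper_rate: "r < x\<^sup>2 / (2 * pair_variance k c) \<Longrightarrow>
      \<forall>\<^sub>F n in sequentially. prob {\<omega> \<in> space M. x \<le> err n k c \<omega> - err n (best c) c \<omega>} \<le> exp (- r * real n)"
    and err_diff_lower_rate: "r > x\<^sup>2 / (2 * pair_variance k c) \<Longrightarrow>
      \<forall>\<^sub>F n in sequentially. exp (- r * real n) \<le> prob {\<omega> \<in> space M. x < err n k c \<omega> - err n (best c) c \<omega>}"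
proof -
  let ?b = "best c"
  define v where "v n = (\<sigma> ?b c)\<^sup>2 / num_samples s n ?b c + (\<sigma> k c)\<^sup>2 / num_samples s n k c" for n
  have b: "?b \<in> K"
    using assms(1) by (rule best_mem)
  have normal: "\<forall>\<^sub>F n in sequentially. sqrt (v n) > 0 \<and>
      distributed M lborel (\<lambda>\<omega>. err n k c \<omega> - err n ?b c \<omega>) (normal_density 0 (sqrt (v n)))"
    using eventually_sampled
  proof eventually_elim
    case (elim n)
    hence "num_samples s n ?b c > 0" "num_samples s n k c > 0"
      using assms b by auto
    thus ?case
      using err_diff_normal[OF assms(2) b assms(3,1)] \<sigma>_pos[OF b assms(1)] \<sigma>_pos[OF assms(2,1)]
      by (simp add: v_def add_pos_pos)
  qed
  have lim: "(\<lambda>n. real n * (sqrt (v n))\<^sup>2) \<longlonglongrightarrow> pair_variance k c"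
  proof -
    have "(sqrt (v n))\<^sup>2 = v n" for n
      by (simp add: v_def)
    moreover have "(\<lambda>n. real n * v n) \<longlonglongrightarrow> pair_variance k c"
      unfolding v_def pair_variance_def distrib_left
      by (intro tendsto_add samples_ratio_lim b assms)
    ultimately show ?thesis
      by simp
  qed
  note * = pair_variance_pos[OF assms(1,2)] assms(4)
  show "r < x\<^sup>2 / (2 * pair_variance k c) \<Longrightarrow>
      \<forall>\<^sub>F n in sequentially. prob {\<omega> \<in> space M. x \<le> err n k c \<omega> - err n ?b c \<omega>} \<le> exp (- r * real n)"
    by (rule normal_tail_upper_rate[OF normal lim *])
  show "r > x\<^sup>2 / (2 * pair_variance k c) \<Longrightarrow>
      \<forall>\<^sub>F n in sequentially. exp (- r * real n) \<le> prob {\<omega> \<in> space M. x < err n k c \<omega> - err n ?b c \<omega>}"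
    by (rule normal_tail_lower_rate[OF normal lim *])
qed

section \<open>False selection at a single context\<close>

definition false_selection :: "nat \<Rightarrow> 'c \<Rightarrow> 'a set" where
  "false_selection n c =
    {\<omega> \<in> space M. best_alternative K (\<lambda>k c. \<mu> n k c \<omega>) c \<noteq> best_alternative K F c}"

lemma \<mu>_measurable [measurable]:
  assumes "k \<in> K" "c \<in> C"
  shows "\<mu> n k c \<in> borel_measurable M"
proof -
  let ?T = "sample_times s n k"
  have y: "y i k c' \<in> borel_measurable M" if "c' \<in> C" for i c'
    using y_eq[OF assms(1) that] assms(1) that by (simp cong: measurable_cong)
  have "(\<lambda>\<omega>. observations s (\<lambda>i k c. y i k c \<omega>) n k ! j) \<in> borel_measurable M"
    if "j < length (sampled_contexts s n k)" for j
    using that y s_mem[of "?T ! j"] by (simp add: sampled_contexts_def observations_def mem_Times_iff)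
  hence "(\<lambda>\<omega>. predicted_reward \<mu>0 \<Sigma>0 \<sigma> s (\<lambda>i k c. y i k c \<omega>) n k c) \<in> borel_measurable M"
    unfolding predicted_reward_def
    by (intro measurable_gp_posterior_mean) (simp_all add: observations_def sampled_contexts_def)
  thus ?thesis
    using \<mu>_eq[OF assms] by (simp cong: measurable_cong)
qed

lemma correct_selection_sets:
  assumes "c \<in> C"
  shows "{\<omega> \<in> space M. best_alternative K (\<lambda>k c. \<mu> n k c \<omega>) c = best_alternative K F c} \<in> sets M"
  using assms by (intro measurable_best_alternative finite_K) simp

lemma false_selection_sets:
  assumes "c \<in> C"
  shows "false_selection n c \<in> sets M"
  using sets.compl_sets[OF correct_selection_sets[OF assms, of n]]
  by (simp add: false_selection_def set_diff_eq conj_commute)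
     (metis (mono_tags, lifting) Collect_cong)

lemma PCS_eq:
  assumes "c \<in> C"
  shows "PCS M K F \<mu> n c = 1 - prob (false_selection n c)"
proof -
  have "{\<omega> \<in> space M. best_alternative K (\<lambda>k c. \<mu> n k c \<omega>) c = best_alternative K F c}
      = space M - false_selection n c"
    by (auto simp: false_selection_def)
  thus ?thesis
    using prob_compl[OF false_selection_sets[OF assms, of n]] by (simp add: PCS_def)
qed

text \<open>If a wrong \<open>k\<close> is selected off the exceptional event, its prediction is at
  least that of the best alternative. Each prediction is within \<open>\<delta>\<close> of its
  average, so the noise difference must cover the gap up to \<open>2 * \<delta>\<close>; a union
  bound over \<open>k\<close> finishes.\<close>

lemma false_selection_upper_rate:
  assumes "c \<in> C" and r: "\<And>k. k \<in> K - {best c} \<Longrightarrow> r < pair_rate k c"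
  shows "\<forall>\<^sub>F n in sequentially. prob (false_selection n c) \<le> exp (- r * real n)"
proof -
  let ?b = "best c" and ?K = "K - {best c}"
  let ?\<Delta> = "\<lambda>k. F (best c) c - F k c"
  \<comment> \<open>The slack must also leave the threshold positive, as the tail bounds hold only
    for nonnegative thresholds; the strict gap to the unique best alternative allows this.\<close>
  have "\<forall>\<^sub>F \<delta> in at_right 0. r < (?\<Delta> k - 2 * \<delta>)\<^sup>2 / (2 * pair_variance k c) \<and> ?\<Delta> k - 2 * \<delta> > 0"
    if k: "k \<in> ?K" for k
  proof (intro eventually_conj)
    have "((\<lambda>\<delta>. (?\<Delta> k - 2 * \<delta>)\<^sup>2 / (2 * pair_variance k c)) \<longlongrightarrow> (?\<Delta> k - 2 * 0)\<^sup>2 / (2 * pair_variance k c)) (at_right 0)"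
      using pair_variance_pos[OF assms(1), of k] k by (intro tendsto_intros) auto
    thus "\<forall>\<^sub>F \<delta> in at_right 0. r < (?\<Delta> k - 2 * \<delta>)\<^sup>2 / (2 * pair_variance k c)"
      using r[OF k] by (intro order_tendstoD) (simp_all add: pair_rate_def)
    have "((\<lambda>\<delta>. ?\<Delta> k - 2 * \<delta>) \<longlongrightarrow> ?\<Delta> k - 2 * 0) (at_right 0)"
      by (intro tendsto_intros)
    thus "\<forall>\<^sub>F \<delta> in at_right 0. ?\<Delta> k - 2 * \<delta> > 0"
      using gap_pos[OF assms(1), of k] k by (intro order_tendstoD) auto
  qed
  hence "\<forall>\<^sub>F \<delta> in at_right 0. \<forall>k\<in>?K. r < (?\<Delta> k - 2 * \<delta>)\<^sup>2 / (2 * pair_variance k c) \<and> ?\<Delta> k - 2 * \<delta> > 0"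
    using finite_K by (intro eventually_ball_finite) auto
  moreover have "\<forall>\<^sub>F \<delta> in at_right 0. \<delta> > (0::real)"
    by (simp add: eventually_at_right_less)
  ultimately have "\<forall>\<^sub>F \<delta> in at_right 0. (\<forall>k\<in>?K. r < (?\<Delta> k - 2 * \<delta>)\<^sup>2 / (2 * pair_variance k c)
      \<and> ?\<Delta> k - 2 * \<delta> > 0) \<and> \<delta> > 0"
    by (rule eventually_conj)
  then obtain \<delta> where \<delta>: "\<delta> > 0"
    "\<And>k. k \<in> ?K \<Longrightarrow> r < (?\<Delta> k - 2 * \<delta>)\<^sup>2 / (2 * pair_variance k c) \<and> ?\<Delta> k - 2 * \<delta> > 0"
    using eventually_happens'[OF trivial_limit_at_right_real] by blast
  \<comment> \<open>Inserting \<open>r + 1\<close> makes the set visibly nonempty while keeping its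
    minimum above \<open>r\<close>.\<close>
  define R where "R = Min (insert (r + 1) ((\<lambda>k. (?\<Delta> k - 2 * \<delta>)\<^sup>2 / (2 * pair_variance k c)) ` ?K))"
  have "r < R"
    using \<delta>(2) finite_K by (auto simp: R_def)
  then obtain r' where r': "r < r'" "r' < R"
    using dense by blast
  obtain L where L: "\<forall>\<^sub>F n in sequentially. prob (large_error n L) \<le> exp (- r' * real n)"
    by (rule large_error_rate)
  let ?ev = "\<lambda>n k. {\<omega> \<in> space M. ?\<Delta> k - 2 * \<delta> \<le> err n k c \<omega> - err n ?b c \<omega>}"
  have "\<forall>\<^sub>F n in sequentially. \<forall>k\<in>?K. prob (?ev n k) \<le> exp (- r' * real n)"
  proof (intro eventually_ball_finite ballI)
    fix k assume k: "k \<in> ?K"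
    have "R \<le> (?\<Delta> k - 2 * \<delta>)\<^sup>2 / (2 * pair_variance k c)"
      using k finite_K by (auto simp: R_def intro!: Min_le)
    thus "\<forall>\<^sub>F n in sequentially. prob (?ev n k) \<le> exp (- r' * real n)"
      using k \<delta>(2)[OF k] r' assms(1) by (intro err_diff_upper_rate) auto
  qed (use finite_K in simp)
  \<comment> \<open>The constant counts the events in the union bound: the exceptional one and one
    for each competitor.\<close>
  with L \<mu>_near_average[OF \<delta>(1), of L] exp_rate_absorb_constant[OF r'(1), of "1 + real (card ?K)"]
  show ?thesis
  proof eventually_elim
    case (elim n)
    have "false_selection n c \<subseteq> large_error n L \<union> (\<Union>k\<in>?K. ?ev n k)"
    proof
      fix \<omega> assume \<omega>: "\<omega> \<in> false_selection n c"
      define k where "k = best_alternative K (\<lambda>k c. \<mu> n k c \<omega>) c"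
      have k: "k \<in> ?K" "\<mu> n ?b c \<omega> \<le> \<mu> n k c \<omega>"
        using best_alternative_maximal[OF finite_K K_nonempty,
            where G = "\<lambda>k c. \<mu> n k c \<omega>" and c = c] \<omega>
          best_mem[OF assms(1)] by (auto simp: k_def false_selection_def best_eq[OF assms(1)])
      show "\<omega> \<in> large_error n L \<union> (\<Union>k\<in>?K. ?ev n k)"
      proof (cases "\<omega> \<in> large_error n L")
        case False
        hence "\<omega> \<in> space M - large_error n L"
          using \<omega> by (simp add: false_selection_def)
        hence "\<bar>\<mu> n k c \<omega> - (F k c + err n k c \<omega>)\<bar> \<le> \<delta>"
          "\<bar>\<mu> n ?b c \<omega> - (F ?b c + err n ?b c \<omega>)\<bar> \<le> \<delta>"
          using elim(2) k(1) assms(1) best_mem[OF assms(1)] by blast+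
        hence "?\<Delta> k - 2 * \<delta> \<le> err n k c \<omega> - err n ?b c \<omega>"
          using k(2) by linarith
        thus ?thesis
          using k(1) \<omega> by (auto simp: false_selection_def)
      qed simp
    qed
    moreover have ev_sets: "?ev n k \<in> sets M" if "k \<in> ?K" for k
      using that assms(1) best_mem[OF assms(1)] by simp
    ultimately have "prob (false_selection n c) \<le> prob (large_error n L \<union> (\<Union>k\<in>?K. ?ev n k))"
      using finite_K by (intro finite_measure_mono sets.Un sets.finite_UN large_error_sets) auto
    also have "\<dots> \<le> prob (large_error n L) + prob (\<Union>k\<in>?K. ?ev n k)"
      using finite_K ev_sets by (intro measure_Un_le sets.finite_UN large_error_sets) auto
    also have "prob (\<Union>k\<in>?K. ?ev n k) \<le> (\<Sum>k\<in>?K. prob (?ev n k))"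
      using finite_K ev_sets by (intro finite_measure_subadditive_finite) auto
    also have "\<dots> \<le> (\<Sum>k\<in>?K. exp (- r' * real n))"
      using elim(4) by (intro sum_mono) simp
    finally have "prob (false_selection n c) \<le> (1 + real (card ?K)) * exp (- r' * real n)"
      using elim(1) by (simp add: algebra_simps)
    thus ?case
      using elim(3) by linarith
  qed
qed

text \<open>One competitor suffices. A noise difference beyond the gap plus
  \<open>2 * \<delta>\<close> forces, off the exceptional event, a strictly larger prediction for
  \<open>k\<close>, so the best alternative loses whatever the tie-breaking rule.\<close>

lemma false_selection_lower_rate:
  assumes c: "c \<in> C" and k: "k \<in> K - {best c}" and r: "pair_rate k c < r"
  shows "\<forall>\<^sub>F n in sequentially. exp (- r * real n) \<le> prob (false_selection n c)"
proof -
  let ?b = "best c" and ?\<Delta> = "F (best c) c - F k c"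
  have "((\<lambda>\<delta>. (?\<Delta> + 2 * \<delta>)\<^sup>2 / (2 * pair_variance k c)) \<longlongrightarrow> (?\<Delta> + 2 * 0)\<^sup>2 / (2 * pair_variance k c)) (at_right 0)"
    using pair_variance_pos[OF c, of k] k by (intro tendsto_intros) auto
  hence "\<forall>\<^sub>F \<delta> in at_right 0. (?\<Delta> + 2 * \<delta>)\<^sup>2 / (2 * pair_variance k c) < r"
    using r by (intro order_tendstoD) (simp_all add: pair_rate_def)
  moreover have "\<forall>\<^sub>F \<delta> in at_right 0. \<delta> > (0::real)"
    by (simp add: eventually_at_right_less)
  ultimately have "\<forall>\<^sub>F \<delta> in at_right 0. (?\<Delta> + 2 * \<delta>)\<^sup>2 / (2 * pair_variance k c) < r \<and> \<delta> > 0"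
    by (rule eventually_conj)
  then obtain \<delta> where \<delta>: "(?\<Delta> + 2 * \<delta>)\<^sup>2 / (2 * pair_variance k c) < r" "\<delta> > 0"
    using eventually_happens'[OF trivial_limit_at_right_real] by blast
  obtain r' where r': "(?\<Delta> + 2 * \<delta>)\<^sup>2 / (2 * pair_variance k c) < r'" "r' < r"
    using dense[OF \<delta>(1)] by blast
  \<comment> \<open>The noise event has the slower rate \<open>r'\<close>, so it eventually has
    probability at least \<open>2 * exp (- r * real n)\<close>; removing the exceptional event still
    leaves \<open>exp (- r * real n)\<close>.\<close>
  obtain L where L: "\<forall>\<^sub>F n in sequentially. prob (large_error n L) \<le> exp (- r * real n)"
    by (rule large_error_rate)
  let ?ev = "\<lambda>n. {\<omega> \<in> space M. ?\<Delta> + 2 * \<delta> < err n k c \<omega> - err n ?b c \<omega>}"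
  have "\<forall>\<^sub>F n in sequentially. exp (- r' * real n) \<le> prob (?ev n)"
    using k r'(1) \<delta>(2) gap_pos[OF c, of k] by (intro err_diff_lower_rate c) auto
  with L \<mu>_near_average[OF \<delta>(2), of L] exp_rate_absorb_constant[OF r'(2), of 2]
  show ?thesis
  proof eventually_elim
    case (elim n)
    have "?ev n \<subseteq> large_error n L \<union> false_selection n c"
    proof
      fix \<omega> assume \<omega>: "\<omega> \<in> ?ev n"
      show "\<omega> \<in> large_error n L \<union> false_selection n c"
      proof (cases "\<omega> \<in> large_error n L")
        case False
        hence "\<bar>\<mu> n k c \<omega> - (F k c + err n k c \<omega>)\<bar> \<le> \<delta>"
          "\<bar>\<mu> n ?b c \<omega> - (F ?b c + err n ?b c \<omega>)\<bar> \<le> \<delta>"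
          using elim(2) k c best_mem[OF c] \<omega> by blast+
        hence "\<mu> n ?b c \<omega> < \<mu> n k c \<omega>"
          using \<omega> by auto
        hence "best_alternative K (\<lambda>k c. \<mu> n k c \<omega>) c \<noteq> ?b"
          using best_alternative_maximal(2)[OF finite_K K_nonempty, where G = "\<lambda>k c. \<mu> n k c \<omega>" and c = c and k = k] k
          by force
        thus ?thesis
          using \<omega> best_eq[OF c] by (simp add: false_selection_def)
      qed simp
    qed
    hence "prob (?ev n) \<le> prob (large_error n L \<union> false_selection n c)"
      by (intro finite_measure_mono sets.Un large_error_sets false_selection_sets c)
    also have "\<dots> \<le> prob (large_error n L) + prob (false_selection n c)"
      by (intro measure_Un_le large_error_sets false_selection_sets c)
    finally show ?case
      using elim by linarith
  qed
qed

section \<open>Combining the contexts\<close>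

definition overall_rate :: real where
  "overall_rate = (MIN c\<in>C. MIN k\<in>K - {best c}. pair_rate k c)"

lemma suboptimal_nonempty: "K - {best c} \<noteq> {}"
proof
  assume "K - {best c} = {}"
  hence "card K \<le> card {best c}"
    by (intro card_mono) auto
  thus False
    using card_K by simp
qed

lemma overall_rate_le:
  assumes "c \<in> C" "k \<in> K - {best c}"
  shows "overall_rate \<le> pair_rate k c"
proof -
  have "overall_rate \<le> (MIN k\<in>K - {best c}. pair_rate k c)"
    unfolding overall_rate_def using assms finite_C by (intro Min_le) auto
  also have "\<dots> \<le> pair_rate k c"
    using assms finite_K by (intro Min_le) auto
  finally show ?thesis .
qed

lemma overall_rate_attained:
  obtains c k where "c \<in> C" "k \<in> K - {best c}" "overall_rate = pair_rate k c"
proof -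
  have "overall_rate \<in> (\<lambda>c. MIN k\<in>K - {best c}. pair_rate k c) ` C"
    unfolding overall_rate_def using finite_C C_nonempty by (intro Min_in) auto
  then obtain c where c: "c \<in> C" "overall_rate = (MIN k\<in>K - {best c}. pair_rate k c)"
    by blast
  have "(MIN k\<in>K - {best c}. pair_rate k c) \<in> (\<lambda>k. pair_rate k c) ` (K - {best c})"
    using finite_K suboptimal_nonempty by (intro Min_in) auto
  thus thesis
    using that c by auto
qed

lemma false_selection_upper_overall:
  assumes "r < overall_rate"
  shows "\<forall>\<^sub>F n in sequentially. \<forall>c\<in>C. prob (false_selection n c) \<le> exp (- r * real n)"
proof (intro eventually_ball_finite finite_C ballI)
  fix c assume "c \<in> C"
  moreover have "r < pair_rate k c" if "k \<in> K - {best c}" for k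
    using assms overall_rate_le[OF \<open>c \<in> C\<close> that] by simp
  ultimately show "\<forall>\<^sub>F n in sequentially. prob (false_selection n c) \<le> exp (- r * real n)"
    by (rule false_selection_upper_rate)
qed

text \<open>A weighted mean of the error probabilities inherits their common upper bound. From below
  it dominates the single term of a context attaining the minimal rate, whose weight is positive and
  hence a constant that an intermediate rate \<open>r'\<close> absorbs.\<close>

lemma PFS_E_rate:
  assumes w: "\<And>c. c \<in> C \<Longrightarrow> w c > 0" "(\<Sum>c\<in>C. w c) = 1"
  shows "(\<lambda>n. 1 / real n * ln (PFS_E M K C w F \<mu> n)) \<longlonglongrightarrow> - overall_rate"
proof -
  have eq: "PFS_E M K C w F \<mu> n = (\<Sum>c\<in>C. w c * prob (false_selection n c))" for n
    using w(2) by (simp add: PFS_E_def PCS_eq right_diff_distrib sum_subtractf)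
  show ?thesis
  proof (rule exp_rate_limit)
    fix r assume "r < overall_rate"
    from false_selection_upper_overall[OF this]
    show "\<forall>\<^sub>F n in sequentially. PFS_E M K C w F \<mu> n \<le> exp (- r * real n)"
    proof eventually_elim
      case (elim n)
      have "PFS_E M K C w F \<mu> n \<le> (\<Sum>c\<in>C. w c * exp (- r * real n))"
        unfolding eq using elim w(1) by (intro sum_mono mult_left_mono) (auto simp: less_imp_le)
      thus ?case
        using w(2) by (simp flip: sum_distrib_right)
    qed
  next
    fix r assume "overall_rate < r"
    then obtain r' where r': "overall_rate < r'" "r' < r"
      using dense by blast
    obtain c k where c: "c \<in> C" "k \<in> K - {best c}" "overall_rate = pair_rate k c"
      by (rule overall_rate_attained)
    from false_selection_lower_rate[OF c(1,2), of r'] r' c(3)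
    have "\<forall>\<^sub>F n in sequentially. exp (- r' * real n) \<le> prob (false_selection n c)"
      by simp
    with exp_rate_absorb_constant[OF r'(2), of "1 / w c"]
    show "\<forall>\<^sub>F n in sequentially. exp (- r * real n) \<le> PFS_E M K C w F \<mu> n"
    proof eventually_elim
      case (elim n)
      have "exp (- r * real n) \<le> w c * exp (- r' * real n)"
        using elim(1) w(1)[OF c(1)] by (simp add: field_simps)
      also have "\<dots> \<le> w c * prob (false_selection n c)"
        using elim(2) w(1)[OF c(1)] by (intro mult_left_mono) auto
      also have "\<dots> \<le> PFS_E M K C w F \<mu> n"
        unfolding eq using c(1) finite_C w(1)
        by (intro member_le_sum) (auto simp: less_imp_le)
      finally show ?case .
    qed
  qed
qed

text \<open>One minus the smallest probability of correct selection is the largest probability of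
  false selection, so both bounds pass over without any constant.\<close>

lemma PFS_M_rate: "(\<lambda>n. 1 / real n * ln (PFS_M M K C F \<mu> n)) \<longlonglongrightarrow> - overall_rate"
proof (rule exp_rate_limit)
  fix r assume "r < overall_rate"
  from false_selection_upper_overall[OF this]
  show "\<forall>\<^sub>F n in sequentially. PFS_M M K C F \<mu> n \<le> exp (- r * real n)"
  proof eventually_elim
    case (elim n)
    hence "1 - exp (- r * real n) \<le> (MIN c\<in>C. PCS M K F \<mu> n c)"
      using finite_C C_nonempty by (intro Min.boundedI) (auto simp: PCS_eq)
    thus ?case
      by (simp add: PFS_M_def)
  qed
next
  fix r assume r: "overall_rate < r"
  obtain c k where c: "c \<in> C" "k \<in> K - {best c}" "overall_rate = pair_rate k c"
    by (rule overall_rate_attained)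
  from r c(3) have "\<forall>\<^sub>F n in sequentially. exp (- r * real n) \<le> prob (false_selection n c)"
    using false_selection_lower_rate[OF c(1,2), of r] by simp
  thus "\<forall>\<^sub>F n in sequentially. exp (- r * real n) \<le> PFS_M M K C F \<mu> n"
  proof eventually_elim
    case (elim n)
    have "(MIN c\<in>C. PCS M K F \<mu> n c) \<le> PCS M K F \<mu> n c"
      using finite_C c(1) by (intro Min_le) auto
    thus ?case
      using elim by (simp add: PFS_M_def PCS_eq[OF c(1)])
  qed
qed

end

theorem theorem4p1:
  fixes M :: "'a measure"
    and K :: "'k set" and C :: "(real ^ 'd) set"
    and F :: "'k \<Rightarrow> real ^ 'd \<Rightarrow> real"
    and \<sigma> :: "'k \<Rightarrow> real ^ 'd \<Rightarrow> real"
    and \<epsilon> y :: "nat \<Rightarrow> 'k \<Rightarrow> real ^ 'd \<Rightarrow> 'a \<Rightarrow> real"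
    and s :: "nat \<Rightarrow> 'k \<times> (real ^ 'd)"
    and p :: "'k \<Rightarrow> real ^ 'd \<Rightarrow> real"
    and \<mu>0 :: "'k \<Rightarrow> real ^ 'd \<Rightarrow> real"
    and \<Sigma>0 :: "'k \<Rightarrow> real ^ 'd \<Rightarrow> real ^ 'd \<Rightarrow> real"
    and \<mu> :: "nat \<Rightarrow> 'k \<Rightarrow> real ^ 'd \<Rightarrow> 'a \<Rightarrow> real"
    and w :: "real ^ 'd \<Rightarrow> real"
    and best :: "real ^ 'd \<Rightarrow> 'k"
  assumes "prob_space M"
    and "finite K" and "card K \<ge> 2"
    and "finite C" and "C \<noteq> {}"
    and "\<And>k c. k \<in> K \<Longrightarrow> c \<in> C \<Longrightarrow> \<sigma> k c > 0"
    and "\<And>i k c \<omega>. k \<in> K \<Longrightarrow> c \<in> C \<Longrightarrow> \<omega> \<in> space M \<Longrightarrow> y i k c \<omega> = F k c + \<epsilon> i k c \<omega>"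
    and "\<And>i k c. k \<in> K \<Longrightarrow> c \<in> C \<Longrightarrow> distributed M lborel (\<epsilon> i k c) (normal_density 0 (\<sigma> k c))"
    and "prob_space.indep_vars M (\<lambda>_. borel) (\<lambda>(i, k, c). \<epsilon> i k c) (UNIV \<times> K \<times> C)"
    and "\<And>c. c \<in> C \<Longrightarrow> \<exists>!k. is_arg_max (\<lambda>k. F k c) (\<lambda>k. k \<in> K) k"
    and "\<And>c. c \<in> C \<Longrightarrow> best c = best_alternative K F c"
    and "\<And>i. s i \<in> K \<times> C"
    and "\<And>k c. k \<in> K \<Longrightarrow> c \<in> C \<Longrightarrow> p k c > 0"
    and "\<And>k c. k \<in> K \<Longrightarrow> c \<in> C \<Longrightarrow> (\<lambda>n. real (num_samples s n k c) / real n) \<longlonglongrightarrow> p k c"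
    and "\<And>k. k \<in> K \<Longrightarrow> positive_definite_kernel_on C (\<Sigma>0 k)"
    and "\<And>n k c \<omega>. k \<in> K \<Longrightarrow> c \<in> C \<Longrightarrow> \<omega> \<in> space M \<Longrightarrow>
           \<mu> n k c \<omega> = predicted_reward \<mu>0 \<Sigma>0 \<sigma> s (\<lambda>i k c. y i k c \<omega>) n k c"
    and "\<And>c. c \<in> C \<Longrightarrow> w c > 0" and "(\<Sum>c\<in>C. w c) = 1"
  shows "(\<lambda>n. 1 / real n * ln (PFS_E M K C w F \<mu> n)) \<longlonglongrightarrow>
           - (MIN c\<in>C. MIN k\<in>K - {best c}.
                (F (best c) c - F k c)\<^sup>2 /
                (2 * ((\<sigma> (best c) c)\<^sup>2 / p (best c) c + (\<sigma> k c)\<^sup>2 / p k c))) \<and>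
         (\<lambda>n. 1 / real n * ln (PFS_M M K C F \<mu> n)) \<longlonglongrightarrow>
           - (MIN c\<in>C. MIN k\<in>K - {best c}.
                (F (best c) c - F k c)\<^sup>2 /
                (2 * ((\<sigma> (best c) c)\<^sup>2 / p (best c) c + (\<sigma> k c)\<^sup>2 / p k c)))"
proof -
  interpret prob_space M
    by fact
  interpret gp_selection M K C F \<sigma> p \<mu>0 \<epsilon> y s \<Sigma>0 \<mu> best
    by (unfold_locales; fact assms)
  show ?thesis
    using PFS_E_rate[OF assms(17,18)] PFS_M_rate
    unfolding overall_rate_def pair_rate_def pair_variance_def by (rule conjI)
qed

end
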